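(* Let $\langle\mathbf{A},i,d\rangle$ be an SLata. Then the following hold: 1. If $\theta$ is a congruence on $\langle\mathbf{A},i,d\rangle$ and $\mathcal{F}_\theta=\{R_{q_\theta}(Q):Q\in\mathcal{X}(\mathbf{A}/\theta)\}$ is the SLata-Vietoris family of the dual SLata-space of $\langle\mathbf{A},i,d\rangle$ obtained from $\theta$, then $\theta=\theta_{\mathcal{F}_\theta}$. 2. If $\mathcal{F}$ is an SLata-Vietoris family of the dual SLata-space of $\langle\mathbf{A},i,d\rangle$, then $$\theta_{\mathcal{F}}=\{(a,b)\in A^2:[\beta(a)^c]^-_{\mathcal{F}}=[\beta(b)^c]^-_{\mathcal{F}}\}$$ is a congruence on $\langle\mathbf{A},i,d\rangle$ such that $\mathcal{F}=\mathcal{F}_{\theta_{\mathcal{F}}}$. Moreover, $\theta_{\mathcal{F}}$ coincides with the kernel of the homomorphism $\Box_{T_{\mathcal{F}}}\beta:\mathbf{A}\to S(\mathcal{F})$. Therefore, there is a one-to-one correspondence between the congruences of $\langle\mathbf{A},i,d\rangle$ and the SLata-Vietoris families of its dual SLata-space.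
   Context: SEMILATTICES. A semilattice is an algebra $\mathbf{A}=\langle A,\wedge,1\rangle$ with $\wedge$ idempotent, commutative, associative and $a\wedge 1=a$ for all $a$; its order is $a\le b$ iff $a=a\wedge b$. For unary operators $i,d$ on $A$, $i\dashv d$ means: for all $a,b\in A$, $i(a)\le b$ iff $a\le d(b)$. An SLata is an algebra $\langle\mathbf{A},i,d\rangle$ with $\mathbf{A}$ a semilattice and $i\dashv d$; congruences are those of the algebra $\langle A,\wedge,1,i,d\rangle$. A filter of $\mathbf{A}$ is an upset containing $1$ and closed under $\wedge$; a proper filter $F$ is irreducible if $F=F_1\cap F_2$ with $F_1,F_2$ filters implies $F=F_1$ or $F=F_2$. $\mathcal{X}(\mathbf{A})$ is the set of irreducible filters, and $\beta(a)=\{P\in\mathcal{X}(\mathbf{A}):a\in P\}$. S-SPACES. A pair $\langle X,\mathcal{K}\rangle$ denotes a set $X$ with the topology having $\mathcal{K}$, a family of subsets of $X$ with $X=\bigcup\mathcal{K}$, as subbase. Put $S(X)=\{U^c:U\in\mathcal{K}\}$ (complements in $X$), and let $C_{\mathcal{K}}(X)=\{\bigcap\mathcal{A}:\mathcal{A}\subseteq S(X)\}$ be the closure system generated by $S(X)$, whose elements are the subbasic closed subsets. For $Y\subseteq X$, a family $\mathcal{J}\subseteq S(X)$ is a $Y$-family if for all $A,B\in\mathcal{J}$ there are $H,C\in S(X)$ with $Y\subseteq H$, $C\in\mathcal{J}$, $A\cap H\subseteq C$ and $B\cap H\subseteq C$. $\langle X,\mathcal{K}\rangle$ is an $S$-space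 if: (S1) it is $T_0$ and $X=\bigcup\mathcal{K}$; (S2) $\mathcal{K}$ is a subbase of compact open subsets, closed under finite unions, with $\emptyset\in\mathcal{K}$; (S3) for $U,V\in\mathcal{K}$ and $x\in U\cap V$ there are $W,D\in\mathcal{K}$ with $x\notin W$, $x\in D$, $D\subseteq(U\cap V)\cup W$; (S4) if $Y\in C_{\mathcal{K}}(X)$ and $\mathcal{J}\subseteq S(X)$ is a $Y$-family with $Y\cap A^c\ne\emptyset$ for all $A\in\mathcal{J}$, then $Y\cap\bigcap\{A^c:A\in\mathcal{J}\}\neq\emptyset$. SLATA-SPACES. For an $S$-space $\langle X,\mathcal{K}\rangle$, $\mathcal{Z}(X)$ is the set of subsets of $X$ that are (possibly infinite) intersections of members of $\mathcal{K}$; for $U\in S(X)$, $L_U=\{Z\in\mathcal{Z}(X):Z\cap U\ne\emptyset\}$. For $R\subseteq X\times\mathcal{Z}(X)$ let $R(x)=\{Z:(x,Z)\in R\}$, $R[Y]=\{Z\in\mathcal{Z}(X):\exists y\in Y\,((y,Z)\in R)\}$, and $m_R(U)=\{x\in X:R(x)\subseteq L_U\}$. $\langle X,\mathcal{K},R\rangle$ is an $mS$-space if $\langle X,\mathcal{K}\rangle$ is an $S$-space, $m_R(U)\in S(X)$ for all $U\in S(X)$, and $R(x)=\bigcap\{L_U:U\in S(X),x\in m_R(U)\}$ for all $x\in X$. $\langle X,\mathcal{K},I,D\rangle$ is an SLata-space if: (1) $\langle X,\mathcal{K},I\rangle$ and $\langle X,\mathcal{K},D\rangle$ are $mS$-spaces;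 (2) for every $U\in S(X)$, if $x\in U$ then for every $Z\in D(x)$ there is $w\in Z$ with $I(w)\subseteq L_U$; (3) for every $U\in S(X)$ and $x\in X$, if for every $Z\in I(x)$ there is $y\in Z$ with $D(y)\subseteq L_U$, then $x\in U$. DUAL SPACE. The dual SLata-space of $\langle\mathbf{A},i,d\rangle$ is $\langle\mathcal{X}(\mathbf{A}),\mathcal{K}_{\mathbf{A}},R_i,R_d\rangle$, where $\mathcal{K}_{\mathbf{A}}=\{\beta(a)^c:a\in A\}$ and, for order-preserving $f:A\to A$, $(P,Z)\in R_f$ iff $f^{-1}[P]\cap\{a\in A:\beta(a)\cap Z=\emptyset\}=\emptyset$, for $P\in\mathcal{X}(\mathbf{A})$, $Z\in\mathcal{Z}(\mathcal{X}(\mathbf{A}))$. VIETORIS FAMILIES. Let $\langle X,\mathcal{K},I,D\rangle$ be an SLata-space and $\mathcal{F}$ a non-empty family of non-empty subbasic closed subsets of $\langle X,\mathcal{K}\rangle$. For $U\subseteq X$ let $U^-_{\mathcal{F}}=[U]^-_{\mathcal{F}}=\{Y\in\mathcal{F}:Y\cap U\ne\emptyset\}$, and let $\mathcal{M}_{\mathcal{F}}=\{U^-_{\mathcal{F}}:U\in\mathcal{K}\}$. A subset $H\subseteq\mathcal{Z}(X)$ is $\mathcal{M}_{\mathcal{F}}$-increasing if $\{V\in\mathcal{K}:\exists U\in H\cap\mathcal{K}\,(U^-_{\mathcal{F}}\subseteq V^-_{\mathcal{F}})\}=H\cap\mathcal{K}$. $\mathcal{F}$ is an SLata-Vietoris family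 if: (1) $\langle\mathcal{F},\mathcal{M}_{\mathcal{F}}\rangle$ is an $S$-space; (2) for every $Y\in\mathcal{F}$, $I[Y]$ and $D[Y]$ are $\mathcal{M}_{\mathcal{F}}$-increasing; (3) $\langle\mathcal{F},\mathcal{M}_{\mathcal{F}},\widehat I,\widehat D\rangle$ is an SLata-space, where for $Y\in\mathcal{F}$, $Z\in\mathcal{Z}(\mathcal{F})$: $(Y,Z)\in\widehat I$ iff $Z\in\bigcap\{L_{(U^-_{\mathcal{F}})^c}:U\in\mathcal{K},U\notin I[Y]\}$, and $(Y,Z)\in\widehat D$ iff $Z\in\bigcap\{L_{(U^-_{\mathcal{F}})^c}:U\in\mathcal{K},U\notin D[Y]\}$. FURTHER NOTATION. For a congruence $\theta$, $q_\theta:A\to A/\theta$ is the canonical map. For a homomorphism $h:\mathbf{A}_1\to\mathbf{A}_2$, $R_h\subseteq\mathcal{X}(\mathbf{A}_2)\times\mathcal{X}(\mathbf{A}_1)$ is given by $(P,Q)\in R_h$ iff $h^{-1}[P]\subseteq Q$, and $R_h(P)=\{Q:(P,Q)\in R_h\}$. For an SLata-Vietoris family $\mathcal{F}$ of the dual SLata-space, $T_{\mathcal{F}}\subseteq\mathcal{F}\times\mathcal{X}(\mathbf{A})$ is given by $(Y,P)\in T_{\mathcal{F}}$ iff $P\in Y$; $\Box_{T_{\mathcal{F}}}(U)=\{Y\in\mathcal{F}:T_{\mathcal{F}}(Y)\subseteq U\}$; $S(\mathcal{F})=\{M^c:M\in\mathcal{M}_{\mathcal{F}}\}$ is a semilattice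 under $\cap$ with greatest element $\mathcal{F}$, equipped with the operators $m_{\widehat I},m_{\widehat D}$.
   Formalization: Y-families are taken non-empty (else no S-space exists); as F_θ is empty for θ = A×A, F_θ is an SLata-Vietoris family only for θ ≠ A×A, and the correspondence is between congruences other than A×A and these families, or all congruences and these families plus the empty one. *)

theory Defs
  imports "HOL-Analysis.Analysis"
begin

section \<open>Semilattices and SLatas\<close>

record 'a semilat =
  carr :: "'a set"
  meet :: "'a \<Rightarrow> 'a \<Rightarrow> 'a"
  unit :: 'a

record 'a slata = "'a semilat" +
  iop :: "'a \<Rightarrow> 'a"
  dop :: "'a \<Rightarrow> 'a"

definition semilattice_alg :: "('a, 'm) semilat_scheme \<Rightarrow> bool" where
  "semilattice_alg A \<longleftrightarrow>
     unit A \<in> carr A \<and>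
     (\<forall>a\<in>carr A. \<forall>b\<in>carr A. meet A a b \<in> carr A) \<and>
     (\<forall>a\<in>carr A. meet A a a = a) \<and>
     (\<forall>a\<in>carr A. \<forall>b\<in>carr A. meet A a b = meet A b a) \<and>
     (\<forall>a\<in>carr A. \<forall>b\<in>carr A. \<forall>c\<in>carr A. meet A (meet A a b) c = meet A a (meet A b c)) \<and>
     (\<forall>a\<in>carr A. meet A a (unit A) = a)"

definition sl_le :: "('a, 'm) semilat_scheme \<Rightarrow> 'a \<Rightarrow> 'a \<Rightarrow> bool" where
  "sl_le A a b \<longleftrightarrow> a = meet A a b"

definition slata_alg :: "'a slata \<Rightarrow> bool" where
  "slata_alg A \<longleftrightarrow>
     semilattice_alg A \<and>
     (\<forall>a\<in>carr A. iop A a \<in> carr A) \<and>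
     (\<forall>a\<in>carr A. dop A a \<in> carr A) \<and>
     (\<forall>a\<in>carr A. \<forall>b\<in>carr A. sl_le A (iop A a) b \<longleftrightarrow> sl_le A a (dop A b))"

definition congruence :: "'a slata \<Rightarrow> ('a \<times> 'a) set \<Rightarrow> bool" where
  "congruence A \<theta> \<longleftrightarrow>
     equiv (carr A) \<theta> \<and>
     (\<forall>a b c d. (a, b) \<in> \<theta> \<and> (c, d) \<in> \<theta> \<longrightarrow> (meet A a c, meet A b d) \<in> \<theta>) \<and>
     (\<forall>a b. (a, b) \<in> \<theta> \<longrightarrow> (iop A a, iop A b) \<in> \<theta>) \<and>
     (\<forall>a b. (a, b) \<in> \<theta> \<longrightarrow> (dop A a, dop A b) \<in> \<theta>)"

definition quot_map :: "('a \<times> 'a) set \<Rightarrow> 'a \<Rightarrow> 'a set" where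
  "quot_map \<theta> a = \<theta> `` {a}"

text \<open>The unions below are over classes that all coincide when \<open>\<theta>\<close> is a congruence.\<close>

definition quotient_slata :: "'a slata \<Rightarrow> ('a \<times> 'a) set \<Rightarrow> 'a set slata" where
  "quotient_slata A \<theta> =
     \<lparr> carr = carr A // \<theta>,
       meet = (\<lambda>C D. \<Union>a\<in>C. \<Union>b\<in>D. quot_map \<theta> (meet A a b)),
       unit = quot_map \<theta> (unit A),
       iop = (\<lambda>C. \<Union>a\<in>C. quot_map \<theta> (iop A a)),
       dop = (\<lambda>C. \<Union>a\<in>C. quot_map \<theta> (dop A a)) \<rparr>"

definition slata_hom :: "'a slata \<Rightarrow> 'b slata \<Rightarrow> ('a \<Rightarrow> 'b) \<Rightarrow> bool" where
  "slata_hom A B h \<longleftrightarrow>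
     (\<forall>a\<in>carr A. h a \<in> carr B) \<and>
     (\<forall>a\<in>carr A. \<forall>b\<in>carr A. h (meet A a b) = meet B (h a) (h b)) \<and>
     h (unit A) = unit B \<and>
     (\<forall>a\<in>carr A. h (iop A a) = iop B (h a)) \<and>
     (\<forall>a\<in>carr A. h (dop A a) = dop B (h a))"

definition hom_kernel :: "('a, 'm) semilat_scheme \<Rightarrow> ('a \<Rightarrow> 'b) \<Rightarrow> ('a \<times> 'a) set" where
  "hom_kernel A h = {(a, b). a \<in> carr A \<and> b \<in> carr A \<and> h a = h b}"

definition sl_filter :: "('a, 'm) semilat_scheme \<Rightarrow> 'a set \<Rightarrow> bool" where
  "sl_filter A F \<longleftrightarrow>
     F \<subseteq> carr A \<and> unit A \<in> F \<and>
     (\<forall>a\<in>F. \<forall>b\<in>carr A. sl_le A a b \<longrightarrow> b \<in> F) \<and>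
     (\<forall>a\<in>F. \<forall>b\<in>F. meet A a b \<in> F)"

definition irr_filters :: "('a, 'm) semilat_scheme \<Rightarrow> 'a set set" where
  "irr_filters A =
     {F. sl_filter A F \<and> F \<noteq> carr A \<and>
         (\<forall>F1 F2. sl_filter A F1 \<and> sl_filter A F2 \<and> F = F1 \<inter> F2 \<longrightarrow> F = F1 \<or> F = F2)}"

definition beta :: "('a, 'm) semilat_scheme \<Rightarrow> 'a \<Rightarrow> 'a set set" where
  "beta A a = {P \<in> irr_filters A. a \<in> P}"


section \<open>S-spaces\<close>

text \<open>A space is given by a set \<open>X\<close> and its subbase \<open>K\<close>; the topology is
  \<open>topology_generated_by K\<close>, whose underlying set is \<open>\<Union>K\<close>.\<close>

definition S_of :: "'x set \<Rightarrow> 'x set set \<Rightarrow> 'x set set" where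
  "S_of X K = {X - U | U. U \<in> K}"

text \<open>Here and in \<open>Z_of\<close>, intersecting with \<open>X\<close> makes the empty intersection equal to \<open>X\<close>.\<close>

definition subbasic_closed :: "'x set \<Rightarrow> 'x set set \<Rightarrow> 'x set set" where
  "subbasic_closed X K = {X \<inter> \<Inter>\<A> | \<A>. \<A> \<subseteq> S_of X K}"

text \<open>A \<open>Y\<close>-family is required to be non-empty: \<open>\<Inter>(S_of X K)\<close> is always empty when \<open>X = \<Union>K\<close>,
  so \<open>Y = {}\<close> is subbasic closed and with \<open>J = {}\<close> the last condition of \<open>S_space\<close>
  would be unsatisfiable.\<close>

definition Y_family :: "'x set \<Rightarrow> 'x set set \<Rightarrow> 'x set \<Rightarrow> 'x set set \<Rightarrow> bool" where
  "Y_family X K Y J \<longleftrightarrow>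
     J \<noteq> {} \<and> J \<subseteq> S_of X K \<and>
     (\<forall>A\<in>J. \<forall>B\<in>J. \<exists>H\<in>S_of X K. \<exists>C\<in>J. Y \<subseteq> H \<and> A \<inter> H \<subseteq> C \<and> B \<inter> H \<subseteq> C)"

definition S_space :: "'x set \<Rightarrow> 'x set set \<Rightarrow> bool" where
  "S_space X K \<longleftrightarrow>
     t0_space (topology_generated_by K) \<and> X = \<Union>K \<and>
     (\<forall>U\<in>K. openin (topology_generated_by K) U \<and> compactin (topology_generated_by K) U) \<and>
     (\<forall>U\<in>K. \<forall>V\<in>K. U \<union> V \<in> K) \<and> {} \<in> K \<and>
     (\<forall>U\<in>K. \<forall>V\<in>K. \<forall>x\<in>U \<inter> V. \<exists>W\<in>K. \<exists>D\<in>K. x \<notin> W \<and> x \<in> D \<and> D \<subseteq> (U \<inter> V) \<union> W) \<and>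
     (\<forall>Y\<in>subbasic_closed X K. \<forall>J. Y_family X K Y J \<and> (\<forall>A\<in>J. Y \<inter> (X - A) \<noteq> {}) \<longrightarrow>
        Y \<inter> (\<Inter>A\<in>J. X - A) \<noteq> {})"


section \<open>SLata-spaces\<close>

definition Z_of :: "'x set \<Rightarrow> 'x set set \<Rightarrow> 'x set set" where
  "Z_of X K = {X \<inter> \<Inter>\<A> | \<A>. \<A> \<subseteq> K}"

definition L_of :: "'x set \<Rightarrow> 'x set set \<Rightarrow> 'x set \<Rightarrow> 'x set set" where
  "L_of X K U = {Z \<in> Z_of X K. Z \<inter> U \<noteq> {}}"

text \<open>For \<open>R \<subseteq> X \<times> Z_of X K\<close>, the sets written \<open>R(x)\<close> and \<open>R[Y]\<close> on paper are
  \<open>R `` {x}\<close> and \<open>R `` Y\<close>.\<close>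

definition m_of ::
  "'x set \<Rightarrow> 'x set set \<Rightarrow> ('x \<times> 'x set) set \<Rightarrow> 'x set \<Rightarrow> 'x set" where
  "m_of X K R U = {x \<in> X. R `` {x} \<subseteq> L_of X K U}"

definition mS_space :: "'x set \<Rightarrow> 'x set set \<Rightarrow> ('x \<times> 'x set) set \<Rightarrow> bool" where
  "mS_space X K R \<longleftrightarrow>
     S_space X K \<and> R \<subseteq> X \<times> Z_of X K \<and>
     (\<forall>U\<in>S_of X K. m_of X K R U \<in> S_of X K) \<and>
     (\<forall>x\<in>X. R `` {x} =
        Z_of X K \<inter> (\<Inter>U\<in>{U \<in> S_of X K. x \<in> m_of X K R U}. L_of X K U))"

definition SLata_space ::
  "'x set \<Rightarrow> 'x set set \<Rightarrow> ('x \<times> 'x set) set \<Rightarrow> ('x \<times> 'x set) set \<Rightarrow> bool" where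
  "SLata_space X K I D \<longleftrightarrow>
     mS_space X K I \<and> mS_space X K D \<and>
     (\<forall>U\<in>S_of X K. \<forall>x\<in>U. \<forall>Z\<in>D `` {x}. \<exists>w\<in>Z. I `` {w} \<subseteq> L_of X K U) \<and>
     (\<forall>U\<in>S_of X K. \<forall>x\<in>X.
        (\<forall>Z\<in>I `` {x}. \<exists>y\<in>Z. D `` {y} \<subseteq> L_of X K U) \<longrightarrow> x \<in> U)"


section \<open>The dual space\<close>

definition K_dual :: "('a, 'm) semilat_scheme \<Rightarrow> 'a set set set" where
  "K_dual A = {irr_filters A - beta A a | a. a \<in> carr A}"

definition R_dual ::
  "('a, 'm) semilat_scheme \<Rightarrow> ('a \<Rightarrow> 'a) \<Rightarrow> ('a set \<times> 'a set set) set" where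
  "R_dual A f =
     {(P, Z). P \<in> irr_filters A \<and> Z \<in> Z_of (irr_filters A) (K_dual A) \<and>
        {a \<in> carr A. f a \<in> P} \<inter> {a \<in> carr A. beta A a \<inter> Z = {}} = {}}"


section \<open>Vietoris families\<close>

text \<open>\<open>hit \<F> U\<close> is the set written \<open>U\<close> with superscript minus and subscript \<open>\<F>\<close> on paper.\<close>

definition hit :: "'x set set \<Rightarrow> 'x set \<Rightarrow> 'x set set" where
  "hit \<F> U = {Y \<in> \<F>. Y \<inter> U \<noteq> {}}"

definition M_of :: "'x set set \<Rightarrow> 'x set set \<Rightarrow> 'x set set set" where
  "M_of K \<F> = {hit \<F> U | U. U \<in> K}"

definition M_increasing :: "'x set set \<Rightarrow> 'x set set \<Rightarrow> 'x set set \<Rightarrow> bool" where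
  "M_increasing K \<F> H \<longleftrightarrow>
     {V \<in> K. \<exists>U\<in>H \<inter> K. hit \<F> U \<subseteq> hit \<F> V} = H \<inter> K"

definition hat_rel ::
  "'x set set \<Rightarrow> 'x set set \<Rightarrow> ('x \<times> 'x set) set \<Rightarrow> ('x set \<times> 'x set set) set" where
  "hat_rel K \<F> R =
     {(Y, Z). Y \<in> \<F> \<and> Z \<in> Z_of \<F> (M_of K \<F>) \<and>
        Z \<in> (\<Inter>U\<in>{U \<in> K. U \<notin> R `` Y}. L_of \<F> (M_of K \<F>) (\<F> - hit \<F> U))}"

definition SLata_Vietoris ::
  "'x set \<Rightarrow> 'x set set \<Rightarrow> ('x \<times> 'x set) set \<Rightarrow> ('x \<times> 'x set) set \<Rightarrow> 'x set set \<Rightarrow> bool" where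
  "SLata_Vietoris X K I D \<F> \<longleftrightarrow>
     SLata_space X K I D \<and>
     \<F> \<noteq> {} \<and> (\<forall>Y\<in>\<F>. Y \<noteq> {} \<and> Y \<in> subbasic_closed X K) \<and>
     S_space \<F> (M_of K \<F>) \<and>
     (\<forall>Y\<in>\<F>. M_increasing K \<F> (I `` Y) \<and> M_increasing K \<F> (D `` Y)) \<and>
     SLata_space \<F> (M_of K \<F>) (hat_rel K \<F> I) (hat_rel K \<F> D)"

definition dual_SLata_Vietoris :: "'a slata \<Rightarrow> 'a set set set \<Rightarrow> bool" where
  "dual_SLata_Vietoris A \<F> \<longleftrightarrow>
     SLata_Vietoris (irr_filters A) (K_dual A) (R_dual A (iop A)) (R_dual A (dop A)) \<F>"


section \<open>Congruences and Vietoris families\<close>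

definition R_hom ::
  "('a, 'm) semilat_scheme \<Rightarrow> ('b, 'n) semilat_scheme \<Rightarrow> ('a \<Rightarrow> 'b) \<Rightarrow> ('b set \<times> 'a set) set" where
  "R_hom A B h =
     {(P, Q). P \<in> irr_filters B \<and> Q \<in> irr_filters A \<and> {a \<in> carr A. h a \<in> P} \<subseteq> Q}"

text \<open>For the total congruence the quotient is trivial and has no irreducible filters, so the
  family is empty; it is then not a \<open>SLata_Vietoris\<close> family, which is non-empty by definition.\<close>

definition family_of_cong :: "'a slata \<Rightarrow> ('a \<times> 'a) set \<Rightarrow> 'a set set set" where
  "family_of_cong A \<theta> =
     {R_hom A (quotient_slata A \<theta>) (quot_map \<theta>) `` {Q} | Q.
        Q \<in> irr_filters (quotient_slata A \<theta>)}"

definition cong_of_family :: "'a slata \<Rightarrow> 'a set set set \<Rightarrow> ('a \<times> 'a) set" where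
  "cong_of_family A \<F> =
     {(a, b). a \<in> carr A \<and> b \<in> carr A \<and>
        hit \<F> (irr_filters A - beta A a) = hit \<F> (irr_filters A - beta A b)}"

definition T_rel :: "'a slata \<Rightarrow> 'a set set set \<Rightarrow> ('a set set \<times> 'a set) set" where
  "T_rel A \<F> = {(Y, P). Y \<in> \<F> \<and> P \<in> irr_filters A \<and> P \<in> Y}"

definition box_T :: "'a slata \<Rightarrow> 'a set set set \<Rightarrow> 'a set set \<Rightarrow> 'a set set set" where
  "box_T A \<F> U = {Y \<in> \<F>. T_rel A \<F> `` {Y} \<subseteq> U}"

definition family_slata :: "'a slata \<Rightarrow> 'a set set set \<Rightarrow> 'a set set set slata" where
  "family_slata A \<F> =
     \<lparr> carr = S_of \<F> (M_of (K_dual A) \<F>),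
       meet = (\<inter>),
       unit = \<F>,
       iop = m_of \<F> (M_of (K_dual A) \<F>) (hat_rel (K_dual A) \<F> (R_dual A (iop A))),
       dop = m_of \<F> (M_of (K_dual A) \<F>) (hat_rel (K_dual A) \<F> (R_dual A (dop A))) \<rparr>"

end

theory Submission
  imports Defs
begin

text \<open>A congruence of an SLata is the kernel of a surjective homomorphism, and a Vietoris family is what
such a homomorphism looks like on the dual side. The proof works throughout with an arbitrary
surjective homomorphism \<open>h : A \<rightarrow> B\<close> instead of a congruence, because the same construction
has to be applied twice: to \<open>A \<rightarrow> A/\<theta>\<close>, and to the homomorphism \<open>a \<mapsto> {Y \<in> \<F>. Y \<subseteq> \<beta>(a)}\<close> from \<open>A\<close> onto the
SLata of closed sets of a given family \<open>\<F>\<close>.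

Let \<open>\<F>\<^sub>h\<close> consist of the sets \<open>R\<^sub>h(Q)\<close> for the irreducible filters \<open>Q\<close> of \<open>B\<close>. As every filter is the
intersection of the irreducible filters above it (\<open>irr_filter_avoiding\<close>), \<open>R\<^sub>h(Q) \<subseteq> \<beta>(a)\<close> holds iff
\<open>h a \<in> Q\<close> (\<open>fibre_subset_beta\<close>). So \<open>\<F>\<^sub>h\<close> is a copy of the dual space of \<open>B\<close>, with the hit sets of the
\<open>\<beta>(a)\<^sup>c\<close> as the copies of the \<open>\<beta>(h a)\<^sup>c\<close> and the two relations on the family as the copies of the dual
relations of \<open>B\<close>. It remains to know that a copy of the dual space of an SLata is an
SLata-space; the locale \<open>slata_rep\<close> proves this for any set of points that is in bijection with the
irreducible filters, which covers the dual space of \<open>A\<close> and the family \<open>\<F>\<^sub>h\<close> at once, without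
transporting topologies along homeomorphisms. Two elements have the same hit set in \<open>\<F>\<^sub>h\<close> iff \<open>h\<close>
identifies them, again because irreducible filters separate points. This is the first half of the
correspondence.

For the second half, let \<open>\<F>\<close> be a Vietoris family. The subbasic closed sets \<open>U\<^sup>c\<close>, for \<open>U\<close> in its
subbase, form an SLata, since the two conditions linking the relations of an SLata-space say exactly
that the box operators are adjoint (\<open>SLata_space_slata_alg\<close>). The map
\<open>a \<mapsto> {Y \<in> \<F>. Y \<subseteq> \<beta>(a)}\<close> is a surjective homomorphism onto it: compatibility with the
operators is what the condition on increasing sets provides (\<open>m_hat_rel\<close>). In an S-space every
irreducible filter of these closed sets consists of those containing one point
(\<open>S_space_irr_filters\<close>), and a member of \<open>\<F>\<close>, being subbasic closed, is determined by the \<open>\<beta>(a)\<close>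
that include it; hence the family of this homomorphism is \<open>\<F>\<close> again (\<open>box_hom_family\<close>). Finally
\<open>\<F>\<^sub>h\<close> depends only on the kernel of \<open>h\<close> (\<open>hom_family_cong_kernel\<close>), so the homomorphism may be
replaced by the quotient map of its kernel.\<close>

section \<open>Semilattices and their irreducible filters\<close>

locale semilat =
  fixes A :: "('a, 'm) semilat_scheme"
  assumes semilattice_alg: "semilattice_alg A"
begin

abbreviation meet_op (infixl "\<sqinter>" 70) where "a \<sqinter> b \<equiv> meet A a b"
abbreviation le_op (infix "\<sqsubseteq>" 50) where "a \<sqsubseteq> b \<equiv> sl_le A a b"

lemma unit_closed [simp]: "unit A \<in> carr A"
  and meet_closed [simp]: "a \<in> carr A \<Longrightarrow> b \<in> carr A \<Longrightarrow> a \<sqinter> b \<in> carr A"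
  and meet_idem [simp]: "a \<in> carr A \<Longrightarrow> a \<sqinter> a = a"
  and meet_comm: "a \<in> carr A \<Longrightarrow> b \<in> carr A \<Longrightarrow> a \<sqinter> b = b \<sqinter> a"
  and meet_assoc: "a \<in> carr A \<Longrightarrow> b \<in> carr A \<Longrightarrow> c \<in> carr A \<Longrightarrow> a \<sqinter> b \<sqinter> c = a \<sqinter> (b \<sqinter> c)"
  and meet_unit [simp]: "a \<in> carr A \<Longrightarrow> a \<sqinter> unit A = a"
  using semilattice_alg unfolding semilattice_alg_def by blast+

lemma le_refl [simp]: "a \<in> carr A \<Longrightarrow> a \<sqsubseteq> a"
  by (simp add: sl_le_def)

lemma le_trans: "a \<sqsubseteq> b \<Longrightarrow> b \<sqsubseteq> c \<Longrightarrow> a \<in> carr A \<Longrightarrow> b \<in> carr A \<Longrightarrow> c \<in> carr A \<Longrightarrow> a \<sqsubseteq> c"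
  unfolding sl_le_def by (metis meet_assoc)

lemma le_antisym: "a \<sqsubseteq> b \<Longrightarrow> b \<sqsubseteq> a \<Longrightarrow> a \<in> carr A \<Longrightarrow> b \<in> carr A \<Longrightarrow> a = b"
  unfolding sl_le_def by (metis meet_comm)

lemma meet_le1: "a \<in> carr A \<Longrightarrow> b \<in> carr A \<Longrightarrow> a \<sqinter> b \<sqsubseteq> a"
  unfolding sl_le_def by (metis meet_assoc meet_closed meet_comm meet_idem)

lemma meet_le2: "a \<in> carr A \<Longrightarrow> b \<in> carr A \<Longrightarrow> a \<sqinter> b \<sqsubseteq> b"
  by (metis meet_comm meet_le1)

lemma meet_greatest:
  "x \<sqsubseteq> a \<Longrightarrow> x \<sqsubseteq> b \<Longrightarrow> x \<in> carr A \<Longrightarrow> a \<in> carr A \<Longrightarrow> b \<in> carr A \<Longrightarrow> x \<sqsubseteq> a \<sqinter> b"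
  unfolding sl_le_def by (metis meet_assoc)

lemma meet_mono:
  "a \<sqsubseteq> b \<Longrightarrow> c \<sqsubseteq> d \<Longrightarrow> a \<in> carr A \<Longrightarrow> b \<in> carr A \<Longrightarrow> c \<in> carr A \<Longrightarrow> d \<in> carr A \<Longrightarrow>
    a \<sqinter> c \<sqsubseteq> b \<sqinter> d"
  by (meson le_trans meet_closed meet_greatest meet_le1 meet_le2)

lemma filter_carr: "sl_filter A F \<Longrightarrow> a \<in> F \<Longrightarrow> a \<in> carr A"
  and filter_unit: "sl_filter A F \<Longrightarrow> unit A \<in> F"
  and filter_up: "sl_filter A F \<Longrightarrow> a \<in> F \<Longrightarrow> a \<sqsubseteq> b \<Longrightarrow> b \<in> carr A \<Longrightarrow> b \<in> F"
  and filter_meet: "sl_filter A F \<Longrightarrow> a \<in> F \<Longrightarrow> b \<in> F \<Longrightarrow> a \<sqinter> b \<in> F"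
  unfolding sl_filter_def by blast+

lemma filter_meet_iff:
  assumes "sl_filter A F" "a \<in> carr A" "b \<in> carr A"
  shows "a \<sqinter> b \<in> F \<longleftrightarrow> a \<in> F \<and> b \<in> F"
  using assms by (meson filter_meet filter_up meet_le1 meet_le2)

lemma principal_filter: "a \<in> carr A \<Longrightarrow> sl_filter A {b \<in> carr A. a \<sqsubseteq> b}"
  unfolding sl_filter_def by (auto intro: le_trans meet_greatest) (simp add: sl_le_def)

lemma filter_adjoin:
  assumes F: "sl_filter A F" and a: "a \<in> carr A"
  defines "G \<equiv> {b \<in> carr A. \<exists>f\<in>F. a \<sqinter> f \<sqsubseteq> b}"
  shows "sl_filter A G" "F \<subseteq> G" "a \<in> G"
proof -
  note fc = filter_carr[OF F]
  show "a \<in> G" using a filter_unit[OF F] unfolding G_def by (auto intro!: bexI[of _ "unit A"])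
  show "F \<subseteq> G" using a fc unfolding G_def by (auto intro: meet_le2)
  show "sl_filter A G"
    unfolding sl_filter_def
  proof (intro conjI ballI impI)
    show "G \<subseteq> carr A" by (auto simp: G_def)
    show "unit A \<in> G" using \<open>F \<subseteq> G\<close> filter_unit[OF F] by blast
  next
    fix x y assume "x \<in> G" "y \<in> carr A" "x \<sqsubseteq> y"
    then show "y \<in> G" unfolding G_def using a fc by simp (meson le_trans meet_closed)
  next
    fix x y assume "x \<in> G" "y \<in> G"
    then obtain f g where fg: "f \<in> F" "g \<in> F" "a \<sqinter> f \<sqsubseteq> x" "a \<sqinter> g \<sqsubseteq> y" "x \<in> carr A" "y \<in> carr A"
      unfolding G_def by blast
    have "f \<sqinter> g \<in> F" using F fg filter_meet by blast
    moreover have "a \<sqinter> (f \<sqinter> g) \<sqsubseteq> a \<sqinter> f" "a \<sqinter> (f \<sqinter> g) \<sqsubseteq> a \<sqinter> g"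
      using a fg fc by (auto intro!: meet_mono meet_le1 meet_le2)
    then have "a \<sqinter> (f \<sqinter> g) \<sqsubseteq> x \<sqinter> y"
      using a fg fc by (meson le_trans meet_closed meet_greatest)
    ultimately show "x \<sqinter> y \<in> G" unfolding G_def using fg by auto
  qed
qed

lemma irr_filter: "P \<in> irr_filters A \<Longrightarrow> sl_filter A P"
  and irr_proper: "P \<in> irr_filters A \<Longrightarrow> P \<noteq> carr A"
  by (auto simp: irr_filters_def)

text \<open>Irreducibility of \<open>P\<close> amounts to the complement of \<open>P\<close> being directed up to meets with elements of
\<open>P\<close>. This form, proved in both directions here and in \<open>irr_directed\<close>, mentions no other filters, and
under \<open>\<beta>\<close> it turns into axiom (S3) of an S-space.\<close>

lemma irr_filtersI:
  assumes P: "sl_filter A P" "P \<noteq> carr A"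
    and dir: "\<And>a b. a \<in> carr A - P \<Longrightarrow> b \<in> carr A - P \<Longrightarrow>
      \<exists>f\<in>P. \<exists>c\<in>carr A - P. a \<sqinter> f \<sqsubseteq> c \<and> b \<sqinter> f \<sqsubseteq> c"
  shows "P \<in> irr_filters A"
  unfolding irr_filters_def
proof (intro CollectI conjI allI impI P, elim conjE)
  fix F G assume FG: "sl_filter A F" "sl_filter A G" "P = F \<inter> G"
  show "P = F \<or> P = G"
  proof (rule ccontr)
    assume "\<not> ?thesis"
    then obtain a b where "a \<in> F - P" "b \<in> G - P" using FG by blast
    moreover from this obtain f c where "f \<in> P" "c \<in> carr A - P" "a \<sqinter> f \<sqsubseteq> c" "b \<sqinter> f \<sqsubseteq> c"
      using dir[of a b] FG filter_carr by blast
    ultimately have "c \<in> F \<inter> G" using FG by (metis DiffE IntE IntI filter_meet filter_up)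
    then show False using \<open>c \<in> carr A - P\<close> FG by blast
  qed
qed

lemma irr_directed:
  assumes P: "P \<in> irr_filters A" and ab: "a \<in> carr A - P" "b \<in> carr A - P"
  obtains f c where "f \<in> P" "c \<in> carr A - P" "a \<sqinter> f \<sqsubseteq> c" "b \<sqinter> f \<sqsubseteq> c"
proof -
  define G where "G x = {b \<in> carr A. \<exists>f\<in>P. x \<sqinter> f \<sqsubseteq> b}" for x
  note fP = irr_filter[OF P]
  have G: "sl_filter A (G x)" "P \<subseteq> G x" "x \<in> G x" if "x \<in> carr A" for x
    using filter_adjoin[OF fP that] by (simp_all add: G_def)
  have "P \<noteq> G a" "P \<noteq> G b" using G ab by blast+
  then have "P \<noteq> G a \<inter> G b" using P G ab unfolding irr_filters_def by blast
  then obtain c where c: "c \<in> G a" "c \<in> G b" "c \<notin> P" using G ab by blast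
  then obtain f g where fg: "f \<in> P" "g \<in> P" "a \<sqinter> f \<sqsubseteq> c" "b \<sqinter> g \<sqsubseteq> c" "c \<in> carr A"
    unfolding G_def by blast
  note fc = filter_carr[OF fP]
  have "a \<sqinter> (f \<sqinter> g) \<sqsubseteq> a \<sqinter> f" "b \<sqinter> (f \<sqinter> g) \<sqsubseteq> b \<sqinter> g"
    using ab fg fc by (auto intro!: meet_mono meet_le1 meet_le2)
  then have "a \<sqinter> (f \<sqinter> g) \<sqsubseteq> c" "b \<sqinter> (f \<sqinter> g) \<sqsubseteq> c"
    using ab fg fc by (meson le_trans meet_closed DiffD1)+
  then show thesis using that[of "f \<sqinter> g" c] fg c filter_meet[OF fP] by blast
qed

text \<open>The semilattice version of the prime filter theorem. The role of the ideal is played by a set \<open>J\<close>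
that is directed up to meets with elements of \<open>F\<close>, which is the algebraic content of a \<open>Y\<close>-family. A filter that is maximal among those above \<open>F\<close> and
disjoint from \<open>J\<close> is irreducible: two strictly larger filters both meet \<open>J\<close>, and then directedness
yields a common element of the two in \<open>J\<close>.\<close>

lemma irr_filter_separation:
  assumes F: "sl_filter A F" and J: "J \<noteq> {}" "J \<subseteq> carr A" "F \<inter> J = {}"
    and dir: "\<And>a b. a \<in> J \<Longrightarrow> b \<in> J \<Longrightarrow> \<exists>h\<in>F. \<exists>c\<in>J. a \<sqinter> h \<sqsubseteq> c \<and> b \<sqinter> h \<sqsubseteq> c"
  obtains P where "P \<in> irr_filters A" "F \<subseteq> P" "P \<inter> J = {}"
proof -
  define \<G> where "\<G> = {G. sl_filter A G \<and> F \<subseteq> G \<and> G \<inter> J = {}}"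
  have "\<exists>M\<in>\<G>. \<forall>X\<in>\<G>. M \<subseteq> X \<longrightarrow> X = M"
  proof (rule subset_Zorn_nonempty)
    show "\<G> \<noteq> {}" using F J by (auto simp: \<G>_def)
  next
    fix \<C> assume ne: "\<C> \<noteq> {}" and ch: "subset.chain \<G> \<C>"
    then have \<C>: "\<C> \<subseteq> \<G>" and tot: "\<And>G H. G \<in> \<C> \<Longrightarrow> H \<in> \<C> \<Longrightarrow> G \<subseteq> H \<or> H \<subseteq> G"
      by (auto simp: subset.chain_def)
    have "sl_filter A (\<Union>\<C>)"
      unfolding sl_filter_def
    proof (intro conjI ballI impI)
      show "\<Union>\<C> \<subseteq> carr A" "unit A \<in> \<Union>\<C>" using \<C> ne filter_carr filter_unit unfolding \<G>_def by blast+
    next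
      fix a b assume "a \<in> \<Union>\<C>" "b \<in> carr A" "a \<sqsubseteq> b"
      then show "b \<in> \<Union>\<C>" using \<C> filter_up unfolding \<G>_def by blast
    next
      fix a b assume "a \<in> \<Union>\<C>" "b \<in> \<Union>\<C>"
      then obtain G where "G \<in> \<C>" "a \<in> G" "b \<in> G" using tot by blast
      then show "a \<sqinter> b \<in> \<Union>\<C>" using \<C> filter_meet unfolding \<G>_def by blast
    qed
    then show "\<Union>\<C> \<in> \<G>" using \<C> ne unfolding \<G>_def by blast
  qed
  then obtain P where "P \<in> \<G>" and max0: "\<forall>X\<in>\<G>. P \<subseteq> X \<longrightarrow> X = P" by blast
  then have P: "sl_filter A P" "F \<subseteq> P" "P \<inter> J = {}" by (auto simp: \<G>_def)
  have max: "G = P" if "sl_filter A G" "P \<subseteq> G" "G \<inter> J = {}" for G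
    using max0 that P(2) by (auto simp: \<G>_def)
  have "P \<in> irr_filters A"
    unfolding irr_filters_def
  proof (intro CollectI conjI allI impI)
    show "P \<noteq> carr A" using P J by blast
  next
    fix G H assume GH: "sl_filter A G \<and> sl_filter A H \<and> P = G \<inter> H"
    show "P = G \<or> P = H"
    proof (rule ccontr)
      assume "\<not> ?thesis"
      then have "G \<inter> J \<noteq> {}" "H \<inter> J \<noteq> {}" using GH max[of G] max[of H] by auto
      then obtain a b where ab: "a \<in> G" "a \<in> J" "b \<in> H" "b \<in> J" by blast
      then obtain h c where "h \<in> F" "c \<in> J" "a \<sqinter> h \<sqsubseteq> c" "b \<sqinter> h \<sqsubseteq> c" using dir by blast
      moreover from this have "a \<sqinter> h \<in> G" "b \<sqinter> h \<in> H" using ab GH P filter_meet by blast+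
      ultimately have "c \<in> G \<inter> H" using GH J filter_up by blast
      then show False using \<open>c \<in> J\<close> GH P by blast
    qed
  qed (use P in auto)
  then show thesis using that P by blast
qed

corollary irr_filter_avoiding:
  assumes "sl_filter A F" "a \<in> carr A" "a \<notin> F"
  obtains P where "P \<in> irr_filters A" "F \<subseteq> P" "a \<notin> P"
proof (rule irr_filter_separation[OF assms(1), of "{a}"])
  show "\<exists>h\<in>F. \<exists>c\<in>{a}. x \<sqinter> h \<sqsubseteq> c \<and> y \<sqinter> h \<sqsubseteq> c" if "x \<in> {a}" "y \<in> {a}" for x y
    using that assms filter_unit[OF assms(1)] by (auto intro!: bexI[of _ "unit A"])
qed (use assms that in auto)

lemma le_iff_irr_filters:
  assumes "a \<in> carr A" "b \<in> carr A"
  shows "a \<sqsubseteq> b \<longleftrightarrow> (\<forall>P\<in>irr_filters A. a \<in> P \<longrightarrow> b \<in> P)"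
proof
  assume "a \<sqsubseteq> b" then show "\<forall>P\<in>irr_filters A. a \<in> P \<longrightarrow> b \<in> P"
    using assms irr_filter filter_up by blast
next
  assume *: "\<forall>P\<in>irr_filters A. a \<in> P \<longrightarrow> b \<in> P"
  show "a \<sqsubseteq> b"
  proof (rule ccontr)
    assume "\<not> a \<sqsubseteq> b"
    then obtain P where "P \<in> irr_filters A" "{c \<in> carr A. a \<sqsubseteq> c} \<subseteq> P" "b \<notin> P"
      using irr_filter_avoiding[OF principal_filter, of a b] assms by blast
    then show False using * assms by auto
  qed
qed

text \<open>Compactness of the complement of \<open>\<beta>(a)\<close>, in algebraic form: if \<open>E\<close> forces \<open>a\<close> into every
irreducible filter, then \<open>a\<close> lies in the filter generated by \<open>E\<close>, hence in one generated by
finitely many elements of \<open>E\<close>.\<close>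

lemma finite_support:
  assumes a: "a \<in> carr A" and E: "E \<subseteq> carr A"
    and ent: "\<And>P. P \<in> irr_filters A \<Longrightarrow> E \<subseteq> P \<Longrightarrow> a \<in> P"
  obtains E' where "finite E'" "E' \<subseteq> E" "\<And>P. sl_filter A P \<Longrightarrow> E' \<subseteq> P \<Longrightarrow> a \<in> P"
proof -
  define G where
    "G = {c \<in> carr A. \<exists>E'. finite E' \<and> E' \<subseteq> E \<and> (\<forall>P. sl_filter A P \<longrightarrow> E' \<subseteq> P \<longrightarrow> c \<in> P)}"
  have G: "sl_filter A G"
    unfolding sl_filter_def
  proof (intro conjI ballI impI)
    show "G \<subseteq> carr A" by (auto simp: G_def)
    show "unit A \<in> G" using filter_unit by (auto simp: G_def)
  next
    fix x y assume x: "x \<in> G" and y: "y \<in> carr A" "x \<sqsubseteq> y"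
    obtain E' where E': "finite E'" "E' \<subseteq> E" "\<forall>P. sl_filter A P \<longrightarrow> E' \<subseteq> P \<longrightarrow> x \<in> P"
      using x by (auto simp: G_def)
    then have "\<forall>P. sl_filter A P \<longrightarrow> E' \<subseteq> P \<longrightarrow> y \<in> P" using y by (metis filter_up)
    then show "y \<in> G" using E' y by (auto simp: G_def)
  next
    fix x y assume x: "x \<in> G" and y: "y \<in> G"
    obtain E1 where E1: "finite E1" "E1 \<subseteq> E" "\<forall>P. sl_filter A P \<longrightarrow> E1 \<subseteq> P \<longrightarrow> x \<in> P" "x \<in> carr A"
      using x by (auto simp: G_def)
    obtain E2 where E2: "finite E2" "E2 \<subseteq> E" "\<forall>P. sl_filter A P \<longrightarrow> E2 \<subseteq> P \<longrightarrow> y \<in> P" "y \<in> carr A"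
      using y by (auto simp: G_def)
    have "\<forall>P. sl_filter A P \<longrightarrow> E1 \<union> E2 \<subseteq> P \<longrightarrow> x \<sqinter> y \<in> P"
      using E1 E2 filter_meet by (simp add: le_sup_iff)
    then show "x \<sqinter> y \<in> G"
      unfolding G_def using E1 E2 by (intro CollectI conjI exI[of _ "E1 \<union> E2"]) auto
  qed
  have EG: "E \<subseteq> G"
    using E unfolding G_def by (auto intro!: exI[of _ "{x}" for x])
  have "a \<in> G"
  proof (rule ccontr)
    assume "a \<notin> G"
    with G a obtain P where "P \<in> irr_filters A" "G \<subseteq> P" "a \<notin> P" by (rule irr_filter_avoiding)
    then show False using ent[of P] EG by auto
  qed
  then obtain E' where "finite E'" "E' \<subseteq> E" "\<forall>P. sl_filter A P \<longrightarrow> E' \<subseteq> P \<longrightarrow> a \<in> P"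
    by (auto simp: G_def)
  then show thesis by (intro that) auto
qed

end

section \<open>Spaces whose points are the irreducible filters\<close>

text \<open>Alexander's subbase lemma, relativised from whole spaces to subsets by passing to the traces of the
subbase on \<open>U\<close>.\<close>

lemma compactin_subbase:
  assumes U: "U \<subseteq> \<Union>K"
    and fin: "\<And>\<C>. \<C> \<subseteq> K \<Longrightarrow> U \<subseteq> \<Union>\<C> \<Longrightarrow> \<exists>\<C>'. finite \<C>' \<and> \<C>' \<subseteq> \<C> \<and> U \<subseteq> \<Union>\<C>'"
  shows "compactin (topology_generated_by K) U"
proof -
  define T where "T = topology (arbitrary union_of (finite intersection_of (\<lambda>V. V \<in> K) relative_to U))"
  have T: "compact_space T"
    by (rule Alexander_subbase_alt[OF U fin T_def[symmetric]])
  have topT: "topspace T = U" by (simp add: T_def)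
  have tr: "openin T (U \<inter> W)" if "generate_topology_on K W" for W
    using that
  proof induction
    case Empty show ?case by simp
  next
    case (Int a b)
    have "U \<inter> (a \<inter> b) = (U \<inter> a) \<inter> (U \<inter> b)" by blast
    then show ?case using Int by auto
  next
    case (UN \<V>)
    then have "openin T (\<Union>((\<inter>) U ` \<V>))" by (intro openin_Union) auto
    moreover have "U \<inter> \<Union>\<V> = \<Union>((\<inter>) U ` \<V>)" by blast
    ultimately show ?case by (simp only:)
  next
    case (Basis V)
    have "(finite intersection_of (\<lambda>V. V \<in> K) relative_to U) (U \<inter> V)"
      using Basis by (intro relative_to_inc finite_intersection_of_inc)
    then show ?case unfolding T_def openin_subbase by (rule arbitrary_union_of_inc)
  qed
  show ?thesis
    unfolding compactin_def topology_generated_by_topspace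
  proof (intro conjI U allI impI, elim conjE)
    fix \<U> assume op: "\<forall>V\<in>\<U>. openin (topology_generated_by K) V" and cov: "U \<subseteq> \<Union>\<U>"
    have "\<forall>V\<in>(\<inter>) U ` \<U>. openin T V" using op tr openin_topology_generated_by by auto
    moreover have "topspace T \<subseteq> \<Union>((\<inter>) U ` \<U>)" using cov topT by auto
    ultimately obtain \<F> where "finite \<F>" "\<F> \<subseteq> (\<inter>) U ` \<U>" "U \<subseteq> \<Union>\<F>"
      using T unfolding compact_space_alt topT by meson
    then obtain \<U>' where "finite \<U>'" "\<U>' \<subseteq> \<U>" "\<F> = (\<inter>) U ` \<U>'" by (meson finite_subset_image)
    moreover from this have "U \<subseteq> \<Union>\<U>'" using \<open>U \<subseteq> \<Union>\<F>\<close> by auto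
    ultimately show "\<exists>\<F>. finite \<F> \<and> \<F> \<subseteq> \<U> \<and> U \<subseteq> \<Union>\<F>" by (intro exI conjI)
  qed
qed

lemma Z_of_K: "V \<in> K \<Longrightarrow> V \<subseteq> X \<Longrightarrow> V \<in> Z_of X K"
  unfolding Z_of_def by (auto intro!: exI[of _ "{V}"])

lemma Z_of_subset: "Z \<in> Z_of X K \<Longrightarrow> Z \<subseteq> X"
  by (auto simp: Z_of_def)

text \<open>A concrete copy of the dual space of \<open>A\<close>: a set \<open>X\<close> whose points are labelled bijectively by the
irreducible filters through \<open>g\<close>. The dual space itself is the case where \<open>g\<close> is the identity; the
family of a homomorphism is another.\<close>

locale point_rep = semilat A
  for A :: "('a, 'm) semilat_scheme" +
  fixes X :: "'x set" and g :: "'x \<Rightarrow> 'a set" and K :: "'x set set"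
  assumes bij: "bij_betw g X (irr_filters A)"
    and K_eq: "K = {{x \<in> X. a \<notin> g x} | a. a \<in> carr A}"
begin

definition up :: "'a \<Rightarrow> 'x set" where "up a = {x \<in> X. a \<in> g x}"

lemma up_iff: "x \<in> up a \<longleftrightarrow> x \<in> X \<and> a \<in> g x"
  by (simp add: up_def)

lemma up_subset: "up a \<subseteq> X"
  by (auto simp: up_def)

lemma mem_K: "V \<in> K \<longleftrightarrow> (\<exists>a\<in>carr A. V = X - up a)"
  unfolding K_eq up_def by auto

lemma S_of_eq: "S_of X K = up ` carr A"
proof -
  have "X - (X - up a) = up a" for a using up_subset by blast
  then show ?thesis unfolding S_of_def by (auto simp: mem_K)
qed

lemma point_irr: "x \<in> X \<Longrightarrow> g x \<in> irr_filters A"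
  using bij by (auto simp: bij_betw_def)

lemma point_filter: "x \<in> X \<Longrightarrow> sl_filter A (g x)"
  using point_irr irr_filter by blast

lemma point_ex:
  assumes "P \<in> irr_filters A" obtains x where "x \<in> X" "g x = P"
  using bij assms that by (metis bij_betw_imp_surj_on imageE)

lemma up_mono:
  assumes "a \<in> carr A" "b \<in> carr A"
  shows "up a \<subseteq> up b \<longleftrightarrow> a \<sqsubseteq> b"
proof -
  have "up a \<subseteq> up b \<longleftrightarrow> (\<forall>x\<in>X. a \<in> g x \<longrightarrow> b \<in> g x)" by (auto simp: up_def)
  also have "\<dots> \<longleftrightarrow> (\<forall>P\<in>g ` X. a \<in> P \<longrightarrow> b \<in> P)" by auto
  also have "\<dots> \<longleftrightarrow> a \<sqsubseteq> b"
    using le_iff_irr_filters[OF assms] bij by (simp add: bij_betw_def)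
  finally show ?thesis .
qed

lemma up_meet: "a \<in> carr A \<Longrightarrow> b \<in> carr A \<Longrightarrow> up (a \<sqinter> b) = up a \<inter> up b"
  using filter_meet_iff[OF point_filter] by (auto simp: up_def)

lemma up_unit: "up (unit A) = X"
  using filter_unit[OF point_filter] by (auto simp: up_def)

lemma Union_K: "X = \<Union>K"
proof
  show "X \<subseteq> \<Union>K"
  proof
    fix x assume x: "x \<in> X"
    then obtain a where "a \<in> carr A" "a \<notin> g x"
      using irr_proper[OF point_irr] filter_carr[OF point_filter] by blast
    then show "x \<in> \<Union>K" using x unfolding K_eq by blast
  qed
qed (auto simp: K_eq)

lemma T0: "t0_space (topology_generated_by K)"
  unfolding t0_space_def topology_generated_by_topspace Union_K[symmetric]
proof (intro ballI impI)
  fix x y assume xy: "x \<in> X" "y \<in> X" "x \<noteq> y"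
  then have "g x \<noteq> g y" using bij by (auto simp: bij_betw_def inj_on_def)
  then obtain a where "a \<in> carr A" "a \<in> g x \<longleftrightarrow> a \<notin> g y"
    using xy filter_carr[OF point_filter] by blast
  moreover from this have "openin (topology_generated_by K) (X - up a)"
    by (intro topology_generated_by_Basis) (auto simp: mem_K)
  moreover from calculation have "(x \<notin> X - up a) = (y \<in> X - up a)" using xy by (simp add: up_iff)
  ultimately show "\<exists>U. openin (topology_generated_by K) U \<and> (x \<notin> U) = (y \<in> U)" by (intro exI conjI)
qed

lemma compact_K:
  assumes "V \<in> K" shows "compactin (topology_generated_by K) V"
proof (rule compactin_subbase)
  show "V \<subseteq> \<Union>K" using assms by blast
next
  fix \<C> assume \<C>: "\<C> \<subseteq> K" "V \<subseteq> \<Union>\<C>"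
  obtain a where a: "a \<in> carr A" "V = X - up a" using assms mem_K by blast
  define E where "E = {e \<in> carr A. X - up e \<in> \<C>}"
  have "a \<in> P" if P: "P \<in> irr_filters A" "E \<subseteq> P" for P
  proof (rule ccontr)
    assume "a \<notin> P"
    obtain x where x: "x \<in> X" "g x = P" using P point_ex by blast
    then have "x \<in> V" using a \<open>a \<notin> P\<close> by (simp add: up_iff)
    then obtain W where W: "W \<in> \<C>" "x \<in> W" using \<C> by blast
    then obtain e where "e \<in> carr A" "W = X - up e" using \<C> mem_K by blast
    then show False using W x P by (auto simp: E_def up_iff)
  qed
  then obtain E' where E': "finite E'" "E' \<subseteq> E" "\<And>P. sl_filter A P \<Longrightarrow> E' \<subseteq> P \<Longrightarrow> a \<in> P"
    using finite_support[of a E] a unfolding E_def by blast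
  have "V \<subseteq> \<Union>((\<lambda>e. X - up e) ` E')"
  proof
    fix x assume "x \<in> V"
    then have "x \<in> X" "a \<notin> g x" using a by (auto simp: up_iff)
    then show "x \<in> \<Union>((\<lambda>e. X - up e) ` E')" using E'(3)[OF point_filter] by (auto simp: up_iff)
  qed
  then show "\<exists>\<C>'. finite \<C>' \<and> \<C>' \<subseteq> \<C> \<and> V \<subseteq> \<Union>\<C>'"
    using E' by (intro exI[of _ "(\<lambda>e. X - up e) ` E'"]) (auto simp: E_def)
qed

text \<open>Axiom (S3), which is the directedness of the complement of the irreducible filter \<open>g x\<close>.\<close>

lemma K_local_directed:
  assumes "U \<in> K" "V \<in> K" "x \<in> U \<inter> V"
  shows "\<exists>W\<in>K. \<exists>D\<in>K. x \<notin> W \<and> x \<in> D \<and> D \<subseteq> (U \<inter> V) \<union> W"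
proof -
  obtain a b where ab: "a \<in> carr A" "b \<in> carr A" "U = X - up a" "V = X - up b"
    using assms mem_K by auto
  then have x: "x \<in> X" "a \<in> carr A - g x" "b \<in> carr A - g x" using assms by (auto simp: up_iff)
  obtain f c where fc: "f \<in> g x" "c \<in> carr A - g x" "a \<sqinter> f \<sqsubseteq> c" "b \<sqinter> f \<sqsubseteq> c"
    using irr_directed[OF point_irr x(2,3)] x(1) by blast
  have f: "f \<in> carr A" using fc x filter_carr[OF point_filter] by blast
  have "up a \<inter> up f \<subseteq> up c" "up b \<inter> up f \<subseteq> up c"
    using up_mono[of "a \<sqinter> f" c] up_mono[of "b \<sqinter> f" c] up_meet[of a f] up_meet[of b f] ab f fc by auto
  then have "X - up c \<subseteq> (U \<inter> V) \<union> (X - up f)" unfolding ab by blast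
  moreover have "X - up c \<in> K" "X - up f \<in> K" using f fc mem_K by auto
  moreover have "x \<notin> X - up f" "x \<in> X - up c" using x fc by (auto simp: up_iff)
  ultimately show ?thesis by (intro bexI[of _ "X - up f"] bexI[of _ "X - up c"] conjI)
qed

text \<open>Axiom (S4). The closed set \<open>Y\<close> corresponds to the filter \<open>F\<close> of all \<open>a\<close> with \<open>Y \<subseteq> up a\<close>, the family
\<open>J\<close> to a set that is directed relative to \<open>F\<close>, and the hypothesis that \<open>Y\<close> is included in no member
of \<open>J\<close> to disjointness. The required point is the irreducible filter separating the two.\<close>

lemma Y_family_meets:
  assumes Y: "Y \<in> subbasic_closed X K" and J: "Y_family X K Y J"
    and ne: "\<forall>B\<in>J. Y \<inter> (X - B) \<noteq> {}"
  shows "Y \<inter> (\<Inter>B\<in>J. X - B) \<noteq> {}"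
proof -
  define F where "F = {a \<in> carr A. Y \<subseteq> up a}"
  define J' where "J' = {a \<in> carr A. up a \<in> J}"
  have JS: "J \<subseteq> up ` carr A" "J \<noteq> {}" using J unfolding Y_family_def S_of_eq by blast+
  have YX: "Y \<subseteq> X" using Y by (auto simp: subbasic_closed_def)
  have Y_eq: "x \<in> Y" if "x \<in> X" "F \<subseteq> g x" for x
  proof -
    obtain \<A> where \<A>: "\<A> \<subseteq> up ` carr A" "Y = X \<inter> \<Inter>\<A>"
      using Y unfolding subbasic_closed_def S_of_eq by blast
    have "x \<in> B" if B: "B \<in> \<A>" for B
    proof -
      obtain a where a: "a \<in> carr A" "B = up a" using \<A> B by auto
      have "Y \<subseteq> B" using \<A> B by auto
      then have "a \<in> F" using a by (simp add: F_def)
      then show ?thesis using a \<open>x \<in> X\<close> \<open>F \<subseteq> g x\<close> by (auto simp: up_iff)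
    qed
    then show ?thesis using \<A> \<open>x \<in> X\<close> by auto
  qed
  have F: "sl_filter A F"
    unfolding sl_filter_def
  proof (intro conjI ballI impI)
    show "F \<subseteq> carr A" "unit A \<in> F" using YX up_unit by (auto simp: F_def)
  next
    fix a b assume "a \<in> F" "b \<in> carr A" "a \<sqsubseteq> b"
    then show "b \<in> F" using up_mono[of a b] by (auto simp: F_def)
  next
    fix a b assume "a \<in> F" "b \<in> F"
    then show "a \<sqinter> b \<in> F" by (auto simp: F_def up_meet)
  qed
  have dir: "\<exists>h\<in>F. \<exists>c\<in>J'. a \<sqinter> h \<sqsubseteq> c \<and> b \<sqinter> h \<sqsubseteq> c" if ab: "a \<in> J'" "b \<in> J'" for a b
  proof -
    have "\<exists>H\<in>S_of X K. \<exists>C\<in>J. Y \<subseteq> H \<and> up a \<inter> H \<subseteq> C \<and> up b \<inter> H \<subseteq> C"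
      using J ab unfolding Y_family_def J'_def by blast
    then obtain h c where hc: "h \<in> carr A" "c \<in> carr A" "up c \<in> J" "Y \<subseteq> up h"
      "up a \<inter> up h \<subseteq> up c" "up b \<inter> up h \<subseteq> up c"
      using JS unfolding S_of_eq by blast
    then have "a \<sqinter> h \<sqsubseteq> c" "b \<sqinter> h \<sqsubseteq> c"
      using ab up_mono[of "a \<sqinter> h" c] up_mono[of "b \<sqinter> h" c] by (auto simp: J'_def up_meet)
    then show ?thesis using hc by (auto simp: F_def J'_def)
  qed
  have "F \<inter> J' = {}" using ne YX by (auto simp: F_def J'_def)
  moreover have "J' \<noteq> {}" "J' \<subseteq> carr A" using JS by (auto simp: J'_def)
  ultimately obtain P where P: "P \<in> irr_filters A" "F \<subseteq> P" "P \<inter> J' = {}"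
    using irr_filter_separation[OF F _ _ _ dir] by blast
  obtain x where x: "x \<in> X" "g x = P" using P point_ex by blast
  have "x \<in> X - B" if B: "B \<in> J" for B
  proof -
    obtain b where "b \<in> carr A" "B = up b" using B JS by blast
    then show ?thesis using B P x by (auto simp: J'_def up_iff)
  qed
  then show ?thesis using x P Y_eq by blast
qed

theorem S_space: "S_space X K"
  unfolding S_space_def
proof (intro conjI ballI allI impI)
  show "t0_space (topology_generated_by K)" by (rule T0)
  show "X = \<Union>K" by (rule Union_K)
  show "openin (topology_generated_by K) U" if "U \<in> K" for U using that by (rule topology_generated_by_Basis)
  show "compactin (topology_generated_by K) U" if "U \<in> K" for U using that by (rule compact_K)
  show "U \<union> V \<in> K" if UV: "U \<in> K" "V \<in> K" for U V
  proof -
    obtain a b where "a \<in> carr A" "b \<in> carr A" "U = X - up a" "V = X - up b" using UV mem_K by auto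
    then have "U \<union> V = X - up (a \<sqinter> b)" "a \<sqinter> b \<in> carr A" by (auto simp: up_meet)
    then show ?thesis using mem_K by blast
  qed
  show "{} \<in> K" using mem_K up_unit by auto
  show "\<exists>W\<in>K. \<exists>D\<in>K. x \<notin> W \<and> x \<in> D \<and> D \<subseteq> U \<inter> V \<union> W" if "U \<in> K" "V \<in> K" "x \<in> U \<inter> V" for U V x
    using that by (rule K_local_directed)
  show "Y \<inter> (\<Inter>B\<in>J. X - B) \<noteq> {}"
    if "Y \<in> subbasic_closed X K" "Y_family X K Y J \<and> (\<forall>B\<in>J. Y \<inter> (X - B) \<noteq> {})" for Y J
    using that Y_family_meets by blast
qed

text \<open>The copy on \<open>X\<close> of the dual relation of the operator \<open>f\<close>.\<close>

definition rel :: "('a \<Rightarrow> 'a) \<Rightarrow> ('x \<times> 'x set) set" where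
  "rel f = {(x, Z). x \<in> X \<and> Z \<in> Z_of X K \<and> (\<forall>a\<in>carr A. f a \<in> g x \<longrightarrow> Z \<inter> up a \<noteq> {})}"

text \<open>The largest set avoiding \<open>up a\<close> is its complement, so if some \<open>Z\<close> related to \<open>x\<close> avoids \<open>up a\<close>, then the
complement does. It is the witness that makes the box operator \<open>m_rel\<close> agree with \<open>f\<close>, and it
connects the relation with the members of \<open>K\<close> that occur in the conditions on Vietoris families.\<close>

lemma rel_complement:
  assumes f: "\<And>a. a \<in> carr A \<Longrightarrow> f a \<in> carr A"
    "\<And>a b. a \<in> carr A \<Longrightarrow> b \<in> carr A \<Longrightarrow> a \<sqsubseteq> b \<Longrightarrow> f a \<sqsubseteq> f b"
    and a: "a \<in> carr A" and x: "x \<in> X"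
  shows "(x, X - up a) \<in> rel f \<longleftrightarrow> f a \<notin> g x"
proof
  assume "(x, X - up a) \<in> rel f"
  then show "f a \<notin> g x" using a by (auto simp: rel_def)
next
  assume fa: "f a \<notin> g x"
  have "(X - up a) \<inter> up b \<noteq> {}" if b: "b \<in> carr A" "f b \<in> g x" for b
  proof
    assume "(X - up a) \<inter> up b = {}"
    then have "up b \<subseteq> up a" using up_subset by blast
    then show False using fa a b f up_mono filter_up[OF point_filter[OF x]] by blast
  qed
  moreover have "X - up a \<in> Z_of X K" by (rule Z_of_K) (use a mem_K in auto)
  ultimately show "(x, X - up a) \<in> rel f" using x by (simp add: rel_def)
qed

lemma m_rel:
  assumes f: "\<And>a. a \<in> carr A \<Longrightarrow> f a \<in> carr A"
    "\<And>a b. a \<in> carr A \<Longrightarrow> b \<in> carr A \<Longrightarrow> a \<sqsubseteq> b \<Longrightarrow> f a \<sqsubseteq> f b" and a: "a \<in> carr A"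
  shows "m_of X K (rel f) (up a) = up (f a)"
proof
  show "up (f a) \<subseteq> m_of X K (rel f) (up a)"
    using a by (auto simp: m_of_def rel_def L_of_def up_iff)
next
  show "m_of X K (rel f) (up a) \<subseteq> up (f a)"
  proof
    fix x assume x: "x \<in> m_of X K (rel f) (up a)"
    then have "x \<in> X" by (simp add: m_of_def)
    moreover have "(x, X - up a) \<notin> rel f" using x by (auto simp: m_of_def L_of_def)
    ultimately show "x \<in> up (f a)" using rel_complement[OF f a] by (simp add: up_iff)
  qed
qed

lemma mS_space:
  assumes f: "\<And>a. a \<in> carr A \<Longrightarrow> f a \<in> carr A"
    "\<And>a b. a \<in> carr A \<Longrightarrow> b \<in> carr A \<Longrightarrow> a \<sqsubseteq> b \<Longrightarrow> f a \<sqsubseteq> f b"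
  shows "mS_space X K (rel f)"
  unfolding mS_space_def
proof (intro conjI S_space ballI)
  show "rel f \<subseteq> X \<times> Z_of X K" by (auto simp: rel_def)
next
  fix U assume "U \<in> S_of X K" then show "m_of X K (rel f) U \<in> S_of X K"
    using f m_rel[OF f] by (auto simp: S_of_eq)
next
  fix x assume x: "x \<in> X"
  have "{U \<in> S_of X K. x \<in> m_of X K (rel f) U} = up ` {a \<in> carr A. f a \<in> g x}"
    using m_rel[OF f] x by (auto simp: S_of_eq up_iff)
  then show "rel f `` {x} =
      Z_of X K \<inter> (\<Inter>U\<in>{U \<in> S_of X K. x \<in> m_of X K (rel f) U}. L_of X K U)"
    using x by (auto simp: rel_def L_of_def)
qed

end

section \<open>SLatas and SLata-spaces\<close>

locale slata =
  fixes A :: "'a slata"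
  assumes slata_alg: "slata_alg A"
begin

sublocale semilat A
  using slata_alg by unfold_locales (simp add: slata_alg_def)

lemma iop_closed [simp]: "a \<in> carr A \<Longrightarrow> iop A a \<in> carr A"
  and dop_closed [simp]: "a \<in> carr A \<Longrightarrow> dop A a \<in> carr A"
  and adjoint: "a \<in> carr A \<Longrightarrow> b \<in> carr A \<Longrightarrow> iop A a \<sqsubseteq> b \<longleftrightarrow> a \<sqsubseteq> dop A b"
  using slata_alg by (auto simp: slata_alg_def)

lemma le_dop_iop: "a \<in> carr A \<Longrightarrow> a \<sqsubseteq> dop A (iop A a)"
  using adjoint[of a "iop A a"] by simp

lemma iop_dop_le: "a \<in> carr A \<Longrightarrow> iop A (dop A a) \<sqsubseteq> a"
  using adjoint[of "dop A a" a] by simp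

lemma iop_mono:
  assumes "a \<in> carr A" "b \<in> carr A" "a \<sqsubseteq> b" shows "iop A a \<sqsubseteq> iop A b"
  using assms le_dop_iop[of b] le_trans[of a b "dop A (iop A b)"] by (simp add: adjoint)

lemma dop_mono:
  assumes "a \<in> carr A" "b \<in> carr A" "a \<sqsubseteq> b" shows "dop A a \<sqsubseteq> dop A b"
  using assms iop_dop_le[of a] le_trans[of "iop A (dop A a)" a b] by (simp flip: adjoint)

end

locale slata_rep = slata A + point_rep A X g K
  for A :: "'a slata" and X :: "'x set" and g K
begin

lemmas m_iop = m_rel[of "iop A", OF iop_closed iop_mono]
lemmas m_dop = m_rel[of "dop A", OF dop_closed dop_mono]

text \<open>Through \<open>m_iop\<close> and \<open>m_dop\<close> the two conditions linking the relations become the unit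
  \<open>a \<le> d(i(a))\<close> and the counit \<open>i(d(a)) \<le> a\<close> of the adjunction.\<close>

theorem SLata_space: "SLata_space X K (rel (iop A)) (rel (dop A))"
  unfolding SLata_space_def
proof (intro conjI ballI impI)
  show "mS_space X K (rel (iop A))" by (rule mS_space[OF iop_closed iop_mono])
  show "mS_space X K (rel (dop A))" by (rule mS_space[OF dop_closed dop_mono])
next
  fix U x Z assume U: "U \<in> S_of X K" "x \<in> U" and Z: "Z \<in> rel (dop A) `` {x}"
  obtain a where a: "a \<in> carr A" "U = up a" using U by (auto simp: S_of_eq)
  have "x \<in> up (dop A (iop A a))" using U a up_mono[of a "dop A (iop A a)"] le_dop_iop by auto
  then have "Z \<inter> up (iop A a) \<noteq> {}" using Z a by (auto simp: rel_def up_iff)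
  then obtain w where "w \<in> Z" "w \<in> m_of X K (rel (iop A)) U" using a m_iop by blast
  then show "\<exists>w\<in>Z. rel (iop A) `` {w} \<subseteq> L_of X K U" by (auto simp: m_of_def)
next
  fix U x assume U: "U \<in> S_of X K" "x \<in> X"
    and *: "\<forall>Z\<in>rel (iop A) `` {x}. \<exists>y\<in>Z. rel (dop A) `` {y} \<subseteq> L_of X K U"
  obtain a where a: "a \<in> carr A" "U = up a" using U by (auto simp: S_of_eq)
  have "Z \<in> L_of X K (m_of X K (rel (dop A)) U)" if Z: "Z \<in> rel (iop A) `` {x}" for Z
  proof -
    have "Z \<in> Z_of X K" using Z by (auto simp: rel_def)
    then show ?thesis using * Z Z_of_subset[of Z X K] unfolding L_of_def m_of_def by blast
  qed
  then have "x \<in> m_of X K (rel (iop A)) (up (dop A a))" using U a m_dop by (auto simp: m_of_def)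
  then have "x \<in> up (iop A (dop A a))" using a m_iop by auto
  then show "x \<in> U" using a up_mono[of "iop A (dop A a)" a] iop_dop_le by auto
qed

end

section \<open>The SLata of an SLata-space\<close>

lemma S_space_props:
  assumes "S_space X K"
  shows S_of_subset: "U \<in> S_of X K \<Longrightarrow> U \<subseteq> X"
    and S_of_complement: "U \<in> S_of X K \<Longrightarrow> X - U \<in> K"
    and S_of_Int: "U \<in> S_of X K \<Longrightarrow> V \<in> S_of X K \<Longrightarrow> U \<inter> V \<in> S_of X K"
    and S_of_top: "X \<in> S_of X K"
proof -
  have K: "X = \<Union>K" "\<And>U V. U \<in> K \<Longrightarrow> V \<in> K \<Longrightarrow> U \<union> V \<in> K" "{} \<in> K"
    using assms unfolding S_space_def by blast+
  have sub: "V \<subseteq> X" if "V \<in> K" for V using K that by auto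
  show "U \<subseteq> X" if "U \<in> S_of X K" for U using that by (auto simp: S_of_def)
  show "X - U \<in> K" if "U \<in> S_of X K" for U
    using that sub by (auto simp: S_of_def double_diff)
  show "X \<in> S_of X K" using K(3) unfolding S_of_def by blast
  show "U \<inter> V \<in> S_of X K" if "U \<in> S_of X K" "V \<in> S_of X K" for U V
  proof -
    obtain U' V' where "U' \<in> K" "V' \<in> K" "U = X - U'" "V = X - V'" using \<open>U \<in> _\<close> \<open>V \<in> _\<close> by (auto simp: S_of_def)
    then have "U \<inter> V = X - (U' \<union> V')" "U' \<union> V' \<in> K" using K(2) by auto
    then show ?thesis unfolding S_of_def by blast
  qed
qed

lemma S_space_semilattice:
  assumes S: "S_space X K" and B: "carr B = S_of X K" "meet B = (\<inter>)" "unit B = X"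
  shows "semilattice_alg B"
  unfolding semilattice_alg_def B
  using S_of_Int[OF S] S_of_subset[OF S] S_of_top[OF S] by (simp add: Int_ac Int_absorb2)

text \<open>S-spaces are sober in the sense appropriate to semilattices. That the sets containing a point form
an irreducible filter is axiom (S3). Conversely, given an irreducible filter \<open>P\<close>, the complement
of \<open>P\<close> is a \<open>Y\<close>-family for \<open>Y = \<Inter>P\<close>; by compactness \<open>Y\<close> is included in no set outside \<open>P\<close>, so axiom
(S4) yields a point of \<open>Y\<close> that lies outside every set not in \<open>P\<close>.\<close>

lemma S_space_irr_filters:
  assumes S: "S_space X K" and B: "carr B = S_of X K" "meet B = (\<inter>)" "unit B = X"
  shows "irr_filters B = (\<lambda>x. {U \<in> S_of X K. x \<in> U}) ` X"
proof -
  interpret B: semilat B using S_space_semilattice[OF assms] by unfold_locales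
  have le: "sl_le B U V \<longleftrightarrow> U \<subseteq> V" for U V unfolding sl_le_def B by blast
  have K: "X = \<Union>K" using S by (simp add: S_space_def)
  have KS: "X - V \<in> S_of X K" if "V \<in> K" for V using that by (auto simp: S_of_def)
  show ?thesis
  proof (intro equalityI subsetI)
    fix P assume "P \<in> (\<lambda>x. {U \<in> S_of X K. x \<in> U}) ` X"
    then obtain x where x: "x \<in> X" and P: "P = {U \<in> S_of X K. x \<in> U}" by blast
    show "P \<in> irr_filters B"
    proof (rule B.irr_filtersI)
      show "sl_filter B P"
        unfolding sl_filter_def le unfolding B P
        using x S_of_top[OF S] S_of_Int[OF S] by auto
      obtain V where "V \<in> K" "x \<in> V" using x K by auto
      then have "X - V \<in> carr B" "X - V \<notin> P" using KS by (simp_all add: B(1) P)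
      then show "P \<noteq> carr B" by metis
    next
      fix U V assume "U \<in> carr B - P" "V \<in> carr B - P"
      then have UV: "U \<in> S_of X K" "V \<in> S_of X K" "x \<notin> U" "x \<notin> V" by (auto simp: B P)
      \<comment> \<open>The local directedness of the complements is irreducibility, read in the space.\<close>
      have "\<exists>W\<in>K. \<exists>D\<in>K. x \<notin> W \<and> x \<in> D \<and> D \<subseteq> ((X - U) \<inter> (X - V)) \<union> W"
        using S S_of_complement[OF S UV(1)] S_of_complement[OF S UV(2)] x UV unfolding S_space_def by blast
      then obtain W D where WD: "W \<in> K" "D \<in> K" "x \<notin> W" "x \<in> D" "D \<subseteq> ((X - U) \<inter> (X - V)) \<union> W" by blast
      have "X - W \<in> P" "X - D \<in> carr B - P" using WD x KS by (auto simp: B P)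
      moreover have "U \<inter> (X - W) \<subseteq> X - D" "V \<inter> (X - W) \<subseteq> X - D" using WD by auto
      ultimately show "\<exists>f\<in>P. \<exists>c\<in>carr B - P. sl_le B (meet B U f) c \<and> sl_le B (meet B V f) c"
        unfolding le B(2) by blast
    qed
  next
    fix P assume P: "P \<in> irr_filters B"
    note fP = B.irr_filter[OF P]
    have PS: "P \<subseteq> S_of X K" using B.filter_carr[OF fP] B by auto
    define Y where "Y = X \<inter> \<Inter>P"
    define J where "J = S_of X K - P"
    have Y: "Y \<in> subbasic_closed X K" using PS unfolding Y_def subbasic_closed_def by auto
    have "Y_family X K Y J"
      unfolding Y_family_def
    proof (intro conjI ballI)
      show "J \<noteq> {}" using B.irr_proper[OF P] PS unfolding J_def B by auto
      show "J \<subseteq> S_of X K" by (auto simp: J_def)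
    next
      fix U V assume "U \<in> J" "V \<in> J"
      then have UV: "U \<in> carr B - P" "V \<in> carr B - P" by (auto simp: J_def B)
      obtain H C where "H \<in> P" "C \<in> carr B - P" "sl_le B (meet B U H) C" "sl_le B (meet B V H) C"
        using B.irr_directed[OF P UV] by blast
      then show "\<exists>H\<in>S_of X K. \<exists>C\<in>J. Y \<subseteq> H \<and> U \<inter> H \<subseteq> C \<and> V \<inter> H \<subseteq> C"
        unfolding le using PS by (intro bexI[of _ H] bexI[of _ C]) (auto simp: B J_def Y_def)
    qed
    moreover have "Y \<inter> (X - U) \<noteq> {}" if U: "U \<in> J" for U
    proof
      assume "Y \<inter> (X - U) = {}"
      then have cov: "X - U \<subseteq> \<Union>((\<lambda>H. X - H) ` P)" by (auto simp: Y_def)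
      have US: "U \<in> S_of X K" "U \<notin> P" using U by (auto simp: J_def)
      have "compactin (topology_generated_by K) (X - U)"
        using S S_of_complement[OF S US(1)] by (simp add: S_space_def)
      moreover have "\<forall>V\<in>(\<lambda>H. X - H) ` P. openin (topology_generated_by K) V"
        using S_of_complement[OF S] PS topology_generated_by_Basis by blast
      ultimately obtain \<F> where "finite \<F>" "\<F> \<subseteq> (\<lambda>H. X - H) ` P" "X - U \<subseteq> \<Union>\<F>"
        using cov unfolding compactin_def by meson
      then obtain E where E: "finite E" "E \<subseteq> P" "X - U \<subseteq> \<Union>((\<lambda>H. X - H) ` E)"
        by (metis finite_subset_image)
      have "X \<inter> \<Inter>E \<in> P" using E(1,2)
      proof (induction E rule: finite_induct)
        case empty show ?case using B.filter_unit[OF fP] by (simp add: B)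
      next
        case (insert H E)
        then have "H \<inter> (X \<inter> \<Inter>E) \<in> P" using B.filter_meet[OF fP, of H "X \<inter> \<Inter>E"] by (simp add: B)
        moreover have "X \<inter> \<Inter>(insert H E) = H \<inter> (X \<inter> \<Inter>E)" by auto
        ultimately show ?case by (simp only:)
      qed
      moreover have "X \<inter> \<Inter>E \<subseteq> U" using E(3) by auto
      ultimately have "U \<in> P" using B.filter_up[OF fP] US le B(1) by auto
      then show False using US by simp
    qed
    ultimately have "Y \<inter> (\<Inter>U\<in>J. X - U) \<noteq> {}" using S Y unfolding S_space_def by meson
    then obtain x where x: "x \<in> Y" "x \<in> (\<Inter>U\<in>J. X - U)" by blast
    then have "\<And>U. U \<in> J \<Longrightarrow> x \<notin> U" by blast
    then have "x \<in> X" "P = {U \<in> S_of X K. x \<in> U}" using x(1) PS by (auto simp: Y_def J_def)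
    then show "P \<in> (\<lambda>x. {U \<in> S_of X K. x \<in> U}) ` X" by blast
  qed
qed

text \<open>The two linking conditions say that \<open>U \<subseteq> m_D (m_I U)\<close> and \<open>m_I (m_D U) \<subseteq> U\<close>; together with
monotonicity of the box operators this is adjointness.\<close>

lemma SLata_space_slata_alg:
  assumes "SLata_space X K I D"
  shows "slata_alg \<lparr>carr = S_of X K, meet = (\<inter>), unit = X, iop = m_of X K I, dop = m_of X K D\<rparr>"
    (is "slata_alg ?B")
proof -
  have I: "mS_space X K I" and D: "mS_space X K D"
    and unit_law: "\<And>U x Z. U \<in> S_of X K \<Longrightarrow> x \<in> U \<Longrightarrow> (x, Z) \<in> D \<Longrightarrow> \<exists>w\<in>Z. I `` {w} \<subseteq> L_of X K U"
    and counit_law: "\<And>U x. U \<in> S_of X K \<Longrightarrow> x \<in> X \<Longrightarrow>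
        (\<And>Z. (x, Z) \<in> I \<Longrightarrow> \<exists>y\<in>Z. D `` {y} \<subseteq> L_of X K U) \<Longrightarrow> x \<in> U"
    using assms unfolding SLata_space_def by auto
  have S: "S_space X K" using I by (simp add: mS_space_def)
  have ID: "I \<subseteq> X \<times> Z_of X K" "D \<subseteq> X \<times> Z_of X K"
    and cl: "\<And>U. U \<in> S_of X K \<Longrightarrow> m_of X K I U \<in> S_of X K"
      "\<And>U. U \<in> S_of X K \<Longrightarrow> m_of X K D U \<in> S_of X K"
    using I D by (auto simp: mS_space_def)
  have adj: "m_of X K I U \<subseteq> V \<longleftrightarrow> U \<subseteq> m_of X K D V" if UV: "U \<in> S_of X K" "V \<in> S_of X K" for U V
  proof
    assume *: "m_of X K I U \<subseteq> V"
    show "U \<subseteq> m_of X K D V"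
    proof
      fix x assume x: "x \<in> U"
      have "Z \<in> L_of X K V" if Z: "(x, Z) \<in> D" for Z
      proof -
        have "Z \<in> Z_of X K" using Z ID by auto
        obtain w where w: "w \<in> Z" "I `` {w} \<subseteq> L_of X K U" using unit_law[OF UV(1) x Z] by blast
        then have "w \<in> V" using * Z_of_subset[OF \<open>Z \<in> Z_of X K\<close>] by (auto simp: m_of_def)
        then show ?thesis using w \<open>Z \<in> Z_of X K\<close> by (auto simp: L_of_def)
      qed
      then show "x \<in> m_of X K D V" using x S_of_subset[OF S UV(1)] by (auto simp: m_of_def)
    qed
  next
    assume *: "U \<subseteq> m_of X K D V"
    show "m_of X K I U \<subseteq> V"
    proof
      fix x assume x: "x \<in> m_of X K I U"
      show "x \<in> V"
      proof (rule counit_law[OF UV(2)])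
        show "x \<in> X" using x by (simp add: m_of_def)
        fix Z assume "(x, Z) \<in> I"
        then have "Z \<in> L_of X K U" using x by (auto simp: m_of_def)
        then obtain y where "y \<in> Z" "y \<in> U" by (auto simp: L_of_def)
        then show "\<exists>y\<in>Z. D `` {y} \<subseteq> L_of X K V" using * by (auto simp: m_of_def)
      qed
    qed
  qed
  have "semilattice_alg ?B" by (rule S_space_semilattice[OF S]) simp_all
  then show ?thesis
    unfolding slata_alg_def sl_le_def using cl adj by (simp add: inf.order_iff[symmetric])
qed

section \<open>Vietoris families in the dual space\<close>

context slata
begin

sublocale dual: slata_rep A "irr_filters A" "\<lambda>P. P" "K_dual A"
proof unfold_locales
  show "bij_betw (\<lambda>P. P) (irr_filters A) (irr_filters A)" by (simp add: bij_betw_def)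
  show "K_dual A = {{P \<in> irr_filters A. a \<notin> P} | a. a \<in> carr A}"
  proof -
    have "irr_filters A - beta A a = {P \<in> irr_filters A. a \<notin> P}" for a by (auto simp: beta_def)
    then show ?thesis by (simp add: K_dual_def)
  qed
qed

lemma dual_up: "dual.up a = beta A a"
  by (simp add: dual.up_def beta_def)

lemma dual_rel: "dual.rel f = R_dual A f"
proof -
  have "{a \<in> carr A. f a \<in> P} \<inter> {a \<in> carr A. beta A a \<inter> Z = {}} = {} \<longleftrightarrow>
      (\<forall>a\<in>carr A. f a \<in> P \<longrightarrow> Z \<inter> beta A a \<noteq> {})" for P and Z :: "'a set set"
    by (auto simp: Int_commute)
  then show ?thesis unfolding dual.rel_def R_dual_def dual_up by simp
qed

lemma dual_SLata_space:
  "SLata_space (irr_filters A) (K_dual A) (R_dual A (iop A)) (R_dual A (dop A))"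
  using dual.SLata_space by (simp add: dual_rel)

lemma R_dual_complement:
  assumes f: "\<And>a. a \<in> carr A \<Longrightarrow> f a \<in> carr A"
    "\<And>a b. a \<in> carr A \<Longrightarrow> b \<in> carr A \<Longrightarrow> a \<sqsubseteq> b \<Longrightarrow> f a \<sqsubseteq> f b"
    and a: "a \<in> carr A" and Y: "Y \<subseteq> irr_filters A"
  shows "irr_filters A - beta A a \<in> R_dual A f `` Y \<longleftrightarrow> \<not> Y \<subseteq> beta A (f a)"
proof -
  have "irr_filters A - beta A a \<in> R_dual A f `` Y \<longleftrightarrow> (\<exists>P\<in>Y. (P, irr_filters A - beta A a) \<in> R_dual A f)"
    by auto
  also have "\<dots> \<longleftrightarrow> (\<exists>P\<in>Y. f a \<notin> P)"
  proof (rule bex_cong[OF refl])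
    fix P assume "P \<in> Y"
    then have "P \<in> irr_filters A" using Y by blast
    then show "(P, irr_filters A - beta A a) \<in> R_dual A f \<longleftrightarrow> f a \<notin> P"
      using dual.rel_complement[of f, OF f a] by (simp add: dual_rel dual_up)
  qed
  also have "\<dots> \<longleftrightarrow> \<not> Y \<subseteq> beta A (f a)" using Y by (auto simp: beta_def)
  finally show ?thesis .
qed

lemma hit_beta:
  assumes "\<forall>Y\<in>\<F>. Y \<subseteq> irr_filters A"
  shows "hit \<F> (irr_filters A - beta A a) = {Y \<in> \<F>. \<not> Y \<subseteq> beta A a}"
  using assms by (auto simp: hit_def)

lemma K_dual_ball: "(\<forall>U\<in>K_dual A. \<phi> U) \<longleftrightarrow> (\<forall>a\<in>carr A. \<phi> (irr_filters A - beta A a))"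
  by (auto simp: K_dual_def)

text \<open>The lifted relation in terms of elements of \<open>A\<close>: by \<open>R_dual_complement\<close>, a subbasic open set
\<open>\<beta>(a)\<^sup>c\<close> lies outside the image of \<open>Y\<close> iff \<open>Y \<subseteq> \<beta>(f a)\<close>. In this form it has the shape of a dual
relation, with \<open>{a. Y \<subseteq> \<beta>(a)}\<close> in the role of the irreducible filter.\<close>

lemma hat_rel_dual:
  assumes f: "\<And>a. a \<in> carr A \<Longrightarrow> f a \<in> carr A"
    "\<And>a b. a \<in> carr A \<Longrightarrow> b \<in> carr A \<Longrightarrow> a \<sqsubseteq> b \<Longrightarrow> f a \<sqsubseteq> f b"
    and \<F>: "\<forall>Y\<in>\<F>. Y \<subseteq> irr_filters A"
  shows "hat_rel (K_dual A) \<F> (R_dual A f) =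
    {(Y, Z). Y \<in> \<F> \<and> Z \<in> Z_of \<F> (M_of (K_dual A) \<F>) \<and>
       (\<forall>a\<in>carr A. Y \<subseteq> beta A (f a) \<longrightarrow> Z \<inter> {W \<in> \<F>. W \<subseteq> beta A a} \<noteq> {})}"
proof -
  have compl: "\<F> - hit \<F> (irr_filters A - beta A a) = {W \<in> \<F>. W \<subseteq> beta A a}" for a
    using hit_beta[OF \<F>] by auto
  have "Z \<in> (\<Inter>U\<in>{U \<in> K_dual A. U \<notin> R_dual A f `` Y}. L_of \<F> (M_of (K_dual A) \<F>) (\<F> - hit \<F> U)) \<longleftrightarrow>
      (\<forall>a\<in>carr A. Y \<subseteq> beta A (f a) \<longrightarrow> Z \<inter> {W \<in> \<F>. W \<subseteq> beta A a} \<noteq> {})"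
    if Y: "Y \<in> \<F>" and Z: "Z \<in> Z_of \<F> (M_of (K_dual A) \<F>)" for Y Z
  proof -
    have "Z \<in> (\<Inter>U\<in>{U \<in> K_dual A. U \<notin> R_dual A f `` Y}. L_of \<F> (M_of (K_dual A) \<F>) (\<F> - hit \<F> U)) \<longleftrightarrow>
      (\<forall>U\<in>K_dual A. U \<notin> R_dual A f `` Y \<longrightarrow> Z \<inter> (\<F> - hit \<F> U) \<noteq> {})"
      using Z by (auto simp: L_of_def)
    also have "\<dots> \<longleftrightarrow> (\<forall>a\<in>carr A. Y \<subseteq> beta A (f a) \<longrightarrow> Z \<inter> {W \<in> \<F>. W \<subseteq> beta A a} \<noteq> {})"
      unfolding K_dual_ball compl using R_dual_complement[of f, OF f] \<F> Y by simp
    finally show ?thesis .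
  qed
  then show ?thesis unfolding hat_rel_def by blast
qed

text \<open>The condition on increasing sets says that \<open>f\<close> is monotone with respect to the preorder that \<open>\<F>\<close>
induces on \<open>A\<close>, as far as \<open>Y\<close> can see. This is what allows \<open>f\<close> to act on the quotient.\<close>

lemma M_increasing_dual:
  assumes f: "\<And>a. a \<in> carr A \<Longrightarrow> f a \<in> carr A"
    "\<And>a b. a \<in> carr A \<Longrightarrow> b \<in> carr A \<Longrightarrow> a \<sqsubseteq> b \<Longrightarrow> f a \<sqsubseteq> f b"
    and \<F>: "\<forall>Y\<in>\<F>. Y \<subseteq> irr_filters A" and Y: "Y \<in> \<F>"
  shows "M_increasing (K_dual A) \<F> (R_dual A f `` Y) \<longleftrightarrow>
    (\<forall>a\<in>carr A. \<forall>b\<in>carr A. {W \<in> \<F>. W \<subseteq> beta A a} \<subseteq> {W \<in> \<F>. W \<subseteq> beta A b} \<longrightarrow>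
       Y \<subseteq> beta A (f a) \<longrightarrow> Y \<subseteq> beta A (f b))"
proof -
  let ?H = "R_dual A f `` Y"
  have "M_increasing (K_dual A) \<F> ?H \<longleftrightarrow>
      (\<forall>V\<in>K_dual A. \<forall>U\<in>K_dual A. U \<in> ?H \<longrightarrow> hit \<F> U \<subseteq> hit \<F> V \<longrightarrow> V \<in> ?H)"
    unfolding M_increasing_def by blast
  also have "\<dots> \<longleftrightarrow> (\<forall>a\<in>carr A. \<forall>b\<in>carr A. \<not> Y \<subseteq> beta A (f b) \<longrightarrow>
      {W \<in> \<F>. \<not> W \<subseteq> beta A b} \<subseteq> {W \<in> \<F>. \<not> W \<subseteq> beta A a} \<longrightarrow> \<not> Y \<subseteq> beta A (f a))"
    unfolding K_dual_ball using R_dual_complement[of f, OF f] \<F> Y by (simp add: hit_beta[OF \<F>])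
  also have "\<dots> \<longleftrightarrow> (\<forall>a\<in>carr A. \<forall>b\<in>carr A. {W \<in> \<F>. W \<subseteq> beta A a} \<subseteq> {W \<in> \<F>. W \<subseteq> beta A b} \<longrightarrow>
       Y \<subseteq> beta A (f a) \<longrightarrow> Y \<subseteq> beta A (f b))"
  proof -
    have compl: "{W \<in> \<F>. \<not> W \<subseteq> beta A b} \<subseteq> {W \<in> \<F>. \<not> W \<subseteq> beta A a} \<longleftrightarrow>
        {W \<in> \<F>. W \<subseteq> beta A a} \<subseteq> {W \<in> \<F>. W \<subseteq> beta A b}" for a b by auto
    show ?thesis unfolding compl by (intro ball_cong refl) argo
  qed
  finally show ?thesis .
qed

end

section \<open>The Vietoris family of a surjective homomorphism\<close>

definition hom_family :: "'a slata \<Rightarrow> 'b slata \<Rightarrow> ('a \<Rightarrow> 'b) \<Rightarrow> 'a set set set" where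
  "hom_family A B h = {R_hom A B h `` {Q} | Q. Q \<in> irr_filters B}"

locale slata_surj = A: slata A + B: slata B
  for A :: "'a slata" and B :: "'b slata" +
  fixes h :: "'a \<Rightarrow> 'b"
  assumes hom: "slata_hom A B h" and surj: "h ` carr A = carr B"
begin

lemma h_closed [simp]: "a \<in> carr A \<Longrightarrow> h a \<in> carr B"
  and h_meet: "a \<in> carr A \<Longrightarrow> b \<in> carr A \<Longrightarrow> h (meet A a b) = meet B (h a) (h b)"
  and h_unit: "h (unit A) = unit B"
  and h_iop: "a \<in> carr A \<Longrightarrow> h (iop A a) = iop B (h a)"
  and h_dop: "a \<in> carr A \<Longrightarrow> h (dop A a) = dop B (h a)"
  using hom by (auto simp: slata_hom_def)

lemma h_surj:
  assumes "b \<in> carr B" obtains a where "a \<in> carr A" "b = h a"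
  using surj assms that by blast

lemma h_mono: "sl_le A a b \<Longrightarrow> a \<in> carr A \<Longrightarrow> b \<in> carr A \<Longrightarrow> sl_le B (h a) (h b)"
  unfolding sl_le_def by (metis h_meet)

definition pull :: "'b set \<Rightarrow> 'a set" where "pull Q = {a \<in> carr A. h a \<in> Q}"

lemma pull_filter:
  assumes Q: "sl_filter B Q" shows "sl_filter A (pull Q)"
  unfolding sl_filter_def
proof (intro conjI ballI impI)
  show "pull Q \<subseteq> carr A" by (auto simp: pull_def)
  show "unit A \<in> pull Q" using B.filter_unit[OF Q] by (simp add: pull_def h_unit)
next
  fix a b assume "a \<in> pull Q" "b \<in> carr A" "sl_le A a b"
  then show "b \<in> pull Q" using B.filter_up[OF Q, of "h a" "h b"] h_mono by (simp add: pull_def)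
next
  fix a b assume "a \<in> pull Q" "b \<in> pull Q"
  then show "meet A a b \<in> pull Q" using B.filter_meet[OF Q] by (simp add: pull_def h_meet)
qed

lemma image_pull: "Q \<subseteq> carr B \<Longrightarrow> h ` pull Q = Q"
  using surj by (auto simp: pull_def)

definition fibre :: "'b set \<Rightarrow> 'a set set" where
  "fibre Q = {P \<in> irr_filters A. pull Q \<subseteq> P}"

lemma fibre_irr: "fibre Q \<subseteq> irr_filters A"
  by (auto simp: fibre_def)

lemma hom_family_fibre: "hom_family A B h = fibre ` irr_filters B"
proof -
  have "R_hom A B h `` {Q} = fibre Q" if "Q \<in> irr_filters B" for Q
    using that by (auto simp: R_hom_def fibre_def pull_def)
  then show ?thesis unfolding hom_family_def by auto
qed

lemma hom_family_irr: "\<forall>Y\<in>hom_family A B h. Y \<subseteq> irr_filters A"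
  using fibre_irr by (auto simp: hom_family_fibre)

text \<open>The filter \<open>pull Q\<close> is the intersection of the irreducible filters above it, so nothing about \<open>Q\<close> is
lost in passing to \<open>fibre Q\<close>. All correspondences between the family and \<open>B\<close> rest on this.\<close>

lemma fibre_subset_beta:
  assumes Q: "sl_filter B Q" and a: "a \<in> carr A"
  shows "fibre Q \<subseteq> beta A a \<longleftrightarrow> h a \<in> Q"
proof
  assume *: "fibre Q \<subseteq> beta A a"
  show "h a \<in> Q"
  proof (rule ccontr)
    assume "h a \<notin> Q"
    then have "a \<notin> pull Q" by (simp add: pull_def)
    with pull_filter[OF Q] a obtain P where "P \<in> irr_filters A" "pull Q \<subseteq> P" "a \<notin> P"
      by (rule A.irr_filter_avoiding)
    then show False using * by (auto simp: fibre_def beta_def)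
  qed
qed (use a in \<open>auto simp: fibre_def beta_def pull_def\<close>)

text \<open>The inverse of \<open>fibre\<close>. It is given by a formula that makes sense for every set of irreducible
filters and recovers \<open>Q\<close> from the \<open>\<beta>(a)\<close> that include \<open>fibre Q\<close>.\<close>

definition point :: "'a set set \<Rightarrow> 'b set" where
  "point Y = {h a | a. a \<in> carr A \<and> Y \<subseteq> beta A a}"

lemma point_fibre:
  assumes Q: "sl_filter B Q" shows "point (fibre Q) = Q"
proof -
  have "point (fibre Q) = h ` pull Q"
    using fibre_subset_beta[OF Q] by (auto simp: point_def pull_def)
  also have "\<dots> = Q" by (rule image_pull) (use B.filter_carr[OF Q] in auto)
  finally show ?thesis .
qed

lemma subset_beta_point:
  assumes "Y \<in> hom_family A B h" "a \<in> carr A"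
  shows "Y \<subseteq> beta A a \<longleftrightarrow> h a \<in> point Y"
proof -
  obtain Q where "Q \<in> irr_filters B" "Y = fibre Q" using assms by (auto simp: hom_family_fibre)
  then show ?thesis using assms(2) fibre_subset_beta point_fibre B.irr_filter by simp
qed

lemma M_of_hom_family:
  "M_of (K_dual A) (hom_family A B h) =
     {{Y \<in> hom_family A B h. b \<notin> point Y} | b. b \<in> carr B}" (is "?L = ?R")
proof -
  have "?L = (\<lambda>a. {Y \<in> hom_family A B h. h a \<notin> point Y}) ` carr A"
  proof -
    have "hit (hom_family A B h) (irr_filters A - beta A a) = {Y \<in> hom_family A B h. h a \<notin> point Y}"
      if "a \<in> carr A" for a
      unfolding A.hit_beta[OF hom_family_irr] using subset_beta_point that by auto
    then have "(\<lambda>a. hit (hom_family A B h) (irr_filters A - beta A a)) ` carr A =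
        (\<lambda>a. {Y \<in> hom_family A B h. h a \<notin> point Y}) ` carr A" by (rule image_cong[OF refl])
    moreover have "?L = (\<lambda>a. hit (hom_family A B h) (irr_filters A - beta A a)) ` carr A"
      unfolding M_of_def K_dual_def by blast
    ultimately show ?thesis by simp
  qed
  also have "\<dots> = (\<lambda>b. {Y \<in> hom_family A B h. b \<notin> point Y}) ` h ` carr A" by (simp add: image_image)
  also have "\<dots> = ?R" unfolding surj by auto
  finally show ?thesis .
qed

text \<open>The family is a copy of the dual space of \<open>B\<close>, hence an SLata-space by the results on \<open>slata_rep\<close>.\<close>

sublocale family: slata_rep B "hom_family A B h" point "M_of (K_dual A) (hom_family A B h)"
proof unfold_locales
  show "bij_betw point (hom_family A B h) (irr_filters B)"
    unfolding hom_family_fibre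
    by (rule bij_betw_byWitness[where f' = fibre]) (use point_fibre B.irr_filter in auto)
qed (rule M_of_hom_family)

lemma subset_beta_up: "a \<in> carr A \<Longrightarrow> {Y \<in> hom_family A B h. Y \<subseteq> beta A a} = family.up (h a)"
  using subset_beta_point by (auto simp: family.up_def)

lemma hat_rel_hom_family:
  assumes f: "\<And>a. a \<in> carr A \<Longrightarrow> f a \<in> carr A"
    "\<And>a b. a \<in> carr A \<Longrightarrow> b \<in> carr A \<Longrightarrow> sl_le A a b \<Longrightarrow> sl_le A (f a) (f b)"
    and hf: "\<And>a. a \<in> carr A \<Longrightarrow> h (f a) = f' (h a)"
  shows "hat_rel (K_dual A) (hom_family A B h) (R_dual A f) = family.rel f'"
proof -
  have "(\<forall>a\<in>carr A. Y \<subseteq> beta A (f a) \<longrightarrow> Z \<inter> {W \<in> hom_family A B h. W \<subseteq> beta A a} \<noteq> {}) \<longleftrightarrow>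
      (\<forall>b\<in>carr B. f' b \<in> point Y \<longrightarrow> Z \<inter> family.up b \<noteq> {})" if "Y \<in> hom_family A B h" for Y Z
    unfolding surj[symmetric] using subset_beta_up subset_beta_point[OF that] f hf by simp
  then have "family.rel f' = {(Y, Z). Y \<in> hom_family A B h \<and>
      Z \<in> Z_of (hom_family A B h) (M_of (K_dual A) (hom_family A B h)) \<and>
      (\<forall>a\<in>carr A. Y \<subseteq> beta A (f a) \<longrightarrow> Z \<inter> {W \<in> hom_family A B h. W \<subseteq> beta A a} \<noteq> {})}"
    unfolding family.rel_def by blast
  moreover have "hat_rel (K_dual A) (hom_family A B h) (R_dual A f) = \<dots>"
    using f hom_family_irr by (rule A.hat_rel_dual)
  ultimately show ?thesis by (simp only:)
qed

lemma M_increasing_hom_family: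
  assumes f: "\<And>a. a \<in> carr A \<Longrightarrow> f a \<in> carr A"
    "\<And>a b. a \<in> carr A \<Longrightarrow> b \<in> carr A \<Longrightarrow> sl_le A a b \<Longrightarrow> sl_le A (f a) (f b)"
    and hf: "\<And>a. a \<in> carr A \<Longrightarrow> h (f a) = f' (h a)"
    and f': "\<And>a b. a \<in> carr B \<Longrightarrow> b \<in> carr B \<Longrightarrow> sl_le B a b \<Longrightarrow> sl_le B (f' a) (f' b)"
    and Y: "Y \<in> hom_family A B h"
  shows "M_increasing (K_dual A) (hom_family A B h) (R_dual A f `` Y)"
proof -
  have "Y \<subseteq> beta A (f b)"
    if ab: "a \<in> carr A" "b \<in> carr A"
    and sub: "{W \<in> hom_family A B h. W \<subseteq> beta A a} \<subseteq> {W \<in> hom_family A B h. W \<subseteq> beta A b}"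
    and fa: "Y \<subseteq> beta A (f a)" for a b
  proof -
    have "sl_le B (h a) (h b)" using sub ab by (simp add: subset_beta_up family.up_mono)
    then have "sl_le B (h (f a)) (h (f b))" using ab f' hf by simp
    moreover have "h (f a) \<in> point Y" using fa subset_beta_point[OF Y] ab f by simp
    ultimately have "h (f b) \<in> point Y"
      using B.filter_up[OF family.point_filter[OF Y]] ab f by simp
    then show ?thesis using subset_beta_point[OF Y] ab f by simp
  qed
  moreover have "M_increasing (K_dual A) (hom_family A B h) (R_dual A f `` Y) \<longleftrightarrow>
      (\<forall>a\<in>carr A. \<forall>b\<in>carr A.
        {W \<in> hom_family A B h. W \<subseteq> beta A a} \<subseteq> {W \<in> hom_family A B h. W \<subseteq> beta A b} \<longrightarrow>
        Y \<subseteq> beta A (f a) \<longrightarrow> Y \<subseteq> beta A (f b))"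
    using f hom_family_irr Y by (rule A.M_increasing_dual)
  ultimately show ?thesis by simp
qed

text \<open>Non-triviality of \<open>B\<close> makes the family non-empty: an element outside the filter \<open>{1}\<close> can be separated
from it by an irreducible filter. The conditions on the lifted relations hold because these are
the copies of the dual relations of \<open>B\<close>.\<close>

theorem hom_family_Vietoris:
  assumes nontriv: "carr B \<noteq> {unit B}"
  shows "dual_SLata_Vietoris A (hom_family A B h)"
  unfolding dual_SLata_Vietoris_def SLata_Vietoris_def
proof (intro conjI ballI)
  show "SLata_space (irr_filters A) (K_dual A) (R_dual A (iop A)) (R_dual A (dop A))"
    by (rule A.dual_SLata_space)
  show "S_space (hom_family A B h) (M_of (K_dual A) (hom_family A B h))"
    by (rule family.S_space)
  show "SLata_space (hom_family A B h) (M_of (K_dual A) (hom_family A B h))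
      (hat_rel (K_dual A) (hom_family A B h) (R_dual A (iop A)))
      (hat_rel (K_dual A) (hom_family A B h) (R_dual A (dop A)))"
    using family.SLata_space
    by (simp add: hat_rel_hom_family[of "iop A" "iop B"] hat_rel_hom_family[of "dop A" "dop B"]
        A.iop_mono A.dop_mono h_iop h_dop)
  show "hom_family A B h \<noteq> {}"
  proof -
    obtain b where b: "b \<in> carr B" "b \<noteq> unit B" using nontriv B.unit_closed by blast
    then have "b \<notin> {c \<in> carr B. sl_le B (unit B) c}"
      using B.meet_comm[of "unit B" b] by (simp add: sl_le_def)
    with B.principal_filter[OF B.unit_closed] b(1) obtain P where "P \<in> irr_filters B"
      by (rule B.irr_filter_avoiding)
    then show ?thesis by (auto simp: hom_family_fibre)
  qed
next
  fix Y assume Y: "Y \<in> hom_family A B h"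
  then obtain Q where Q: "Q \<in> irr_filters B" "Y = fibre Q" by (auto simp: hom_family_fibre)
  obtain a where "a \<in> carr A" "h a \<notin> Q"
    using h_surj B.irr_proper[OF Q(1)] B.filter_carr[OF B.irr_filter[OF Q(1)]] by blast
  then have "\<not> Y \<subseteq> beta A a" using fibre_subset_beta Q B.irr_filter by simp
  then show "Y \<noteq> {}" by auto
  have "Y = irr_filters A \<inter> \<Inter>(beta A ` pull Q)" unfolding Q fibre_def by (auto simp: beta_def)
  moreover have "beta A ` pull Q \<subseteq> S_of (irr_filters A) (K_dual A)"
    unfolding A.dual.S_of_eq A.dual_up by (auto simp: pull_def)
  ultimately show "Y \<in> subbasic_closed (irr_filters A) (K_dual A)"
    unfolding subbasic_closed_def by blast
  show "M_increasing (K_dual A) (hom_family A B h) (R_dual A (iop A) `` Y)"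
    by (rule M_increasing_hom_family[of "iop A" "iop B"])
      (use Y in \<open>auto intro: A.iop_mono B.iop_mono h_iop\<close>)
  show "M_increasing (K_dual A) (hom_family A B h) (R_dual A (dop A) `` Y)"
    by (rule M_increasing_hom_family[of "dop A" "dop B"])
      (use Y in \<open>auto intro: A.dop_mono B.dop_mono h_dop\<close>)
qed

theorem cong_of_hom_family: "cong_of_family A (hom_family A B h) = hom_kernel A h"
proof -
  have "hit (hom_family A B h) (irr_filters A - beta A a) = hit (hom_family A B h) (irr_filters A - beta A b)
      \<longleftrightarrow> h a = h b" if ab: "a \<in> carr A" "b \<in> carr A" for a b
  proof -
    have hit: "hit (hom_family A B h) (irr_filters A - beta A c) = hom_family A B h - family.up (h c)"
      if "c \<in> carr A" for c
      using A.hit_beta[OF hom_family_irr] subset_beta_up[OF that] by auto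
    have "hit (hom_family A B h) (irr_filters A - beta A a) = hit (hom_family A B h) (irr_filters A - beta A b)
        \<longleftrightarrow> family.up (h a) = family.up (h b)"
      unfolding hit[OF ab(1)] hit[OF ab(2)] using family.up_subset by blast
    also have "\<dots> \<longleftrightarrow> sl_le B (h a) (h b) \<and> sl_le B (h b) (h a)"
      using ab by (simp add: set_eq_subset family.up_mono)
    also have "\<dots> \<longleftrightarrow> h a = h b" using ab B.le_antisym by auto
    finally show ?thesis .
  qed
  then show ?thesis unfolding cong_of_family_def hom_kernel_def by blast
qed

text \<open>Filters of \<open>B\<close> correspond to the filters of \<open>A\<close> that are closed under the kernel of \<open>h\<close>, compatibly
with intersections. Irreducible filters of \<open>B\<close> are therefore the irreducible elements among the saturated
filters, a description from which \<open>B\<close> has disappeared except through the kernel.\<close>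

definition saturated_filter :: "'a set \<Rightarrow> bool" where
  "saturated_filter G \<longleftrightarrow> sl_filter A G \<and> (\<forall>(a, b)\<in>hom_kernel A h. a \<in> G \<longrightarrow> b \<in> G)"

lemma saturated_pull: "sl_filter B Q \<Longrightarrow> saturated_filter (pull Q)"
  using pull_filter by (auto simp: saturated_filter_def hom_kernel_def pull_def)

lemma pull_image:
  assumes G: "saturated_filter G" shows "pull (h ` G) = G"
proof
  have GA: "G \<subseteq> carr A" using G A.filter_carr by (auto simp: saturated_filter_def)
  show "G \<subseteq> pull (h ` G)" using GA by (auto simp: pull_def)
  show "pull (h ` G) \<subseteq> G"
  proof
    fix a assume "a \<in> pull (h ` G)"
    then obtain c where c: "a \<in> carr A" "c \<in> G" "h c = h a" by (auto simp: pull_def)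
    then have "(c, a) \<in> hom_kernel A h" using GA by (auto simp: hom_kernel_def)
    then show "a \<in> G" using G c(2) by (auto simp: saturated_filter_def)
  qed
qed

lemma image_filter:
  assumes G: "saturated_filter G" shows "sl_filter B (h ` G)"
proof -
  have fG: "sl_filter A G" using G by (simp add: saturated_filter_def)
  note Gc = A.filter_carr[OF fG]
  show ?thesis
    unfolding sl_filter_def
  proof (intro conjI ballI impI)
    show "h ` G \<subseteq> carr B" using Gc by auto
    show "unit B \<in> h ` G" using A.filter_unit[OF fG] h_unit by (metis imageI)
  next
    fix x y assume "x \<in> h ` G" "y \<in> carr B" and le: "sl_le B x y"
    then obtain a b where ab: "a \<in> G" "x = h a" "b \<in> carr A" "y = h b" using h_surj by blast
    then have "h a = h (meet A a b)" using le Gc by (simp add: sl_le_def h_meet)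
    then have "(a, meet A a b) \<in> hom_kernel A h" using ab Gc by (simp add: hom_kernel_def)
    then have "meet A a b \<in> G" using G ab by (auto simp: saturated_filter_def)
    then have "b \<in> G" using A.filter_meet_iff[OF fG] ab Gc by blast
    then show "y \<in> h ` G" using ab by simp
  next
    fix x y assume "x \<in> h ` G" "y \<in> h ` G"
    then obtain a b where "a \<in> G" "x = h a" "b \<in> G" "y = h b" by blast
    then show "meet B x y \<in> h ` G" using A.filter_meet[OF fG] Gc h_meet by (metis imageI)
  qed
qed

lemma pull_irr_filters:
  "pull ` irr_filters B =
     {G. saturated_filter G \<and> G \<noteq> carr A \<and>
         (\<forall>G1 G2. saturated_filter G1 \<and> saturated_filter G2 \<and> G = G1 \<inter> G2 \<longrightarrow> G = G1 \<or> G = G2)}"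
    (is "_ = ?R")
proof (intro equalityI subsetI)
  have pull_Int: "pull (Q1 \<inter> Q2) = pull Q1 \<inter> pull Q2" for Q1 Q2 by (auto simp: pull_def)
  {
    fix G assume "G \<in> pull ` irr_filters B"
    then obtain Q where Q: "Q \<in> irr_filters B" and G: "G = pull Q" by blast
    note fQ = B.irr_filter[OF Q]
    have QB: "Q \<subseteq> carr B" using B.filter_carr[OF fQ] by auto
    then have hG: "h ` G = Q" unfolding G by (rule image_pull)
    have "G \<noteq> carr A" using hG surj B.irr_proper[OF Q] by metis
    moreover have "G = G1 \<or> G = G2"
      if G12: "saturated_filter G1" "saturated_filter G2" "G = G1 \<inter> G2" for G1 G2
    proof -
      have "pull (h ` G1 \<inter> h ` G2) = G"
        unfolding pull_Int using G12 pull_image by simp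
      moreover have "h ` G1 \<inter> h ` G2 \<subseteq> carr B"
        using B.filter_carr[OF image_filter[OF G12(1)]] by auto
      ultimately have "Q = h ` G1 \<inter> h ` G2" using hG image_pull by metis
      then have "Q = h ` G1 \<or> Q = h ` G2"
        using Q image_filter G12 unfolding irr_filters_def by simp
      then show ?thesis using G12 pull_image G by metis
    qed
    ultimately show "G \<in> ?R" using saturated_pull[OF fQ] G by blast
  next
    fix G assume "G \<in> ?R"
    then have G: "saturated_filter G" "G \<noteq> carr A"
      and prime: "\<And>G1 G2. saturated_filter G1 \<Longrightarrow> saturated_filter G2 \<Longrightarrow> G = G1 \<inter> G2 \<Longrightarrow> G = G1 \<or> G = G2"
      by auto
    have "h ` G \<in> irr_filters B"
      unfolding irr_filters_def
    proof (intro CollectI conjI allI impI)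
      show "sl_filter B (h ` G)" by (rule image_filter[OF G(1)])
      have "pull (carr B) = carr A" by (auto simp: pull_def)
      then show "h ` G \<noteq> carr B" using pull_image[OF G(1)] G(2) by auto
    next
      fix Q1 Q2 assume Q: "sl_filter B Q1 \<and> sl_filter B Q2 \<and> h ` G = Q1 \<inter> Q2"
      then have "G = pull Q1 \<inter> pull Q2" using pull_image[OF G(1)] pull_Int by metis
      then have "G = pull Q1 \<or> G = pull Q2" using prime Q saturated_pull by blast
      moreover have "h ` pull Q1 = Q1" "h ` pull Q2 = Q2"
        using Q B.filter_carr by (auto intro!: image_pull)
      ultimately show "h ` G = Q1 \<or> h ` G = Q2" by metis
    qed
    then show "G \<in> pull ` irr_filters B" using pull_image[OF G(1)] by (metis imageI)
  }
qed

lemma hom_family_pull: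
  "hom_family A B h = (\<lambda>G. {P \<in> irr_filters A. G \<subseteq> P}) ` pull ` irr_filters B"
  unfolding hom_family_fibre fibre_def by (simp add: image_image)

end

theorem hom_family_cong_kernel:
  assumes "slata_surj A B h" "slata_surj A C k" "hom_kernel A h = hom_kernel A k"
  shows "hom_family A B h = hom_family A C k"
proof -
  interpret h: slata_surj A B h by fact
  interpret k: slata_surj A C k by fact
  have "h.saturated_filter = k.saturated_filter"
    unfolding h.saturated_filter_def k.saturated_filter_def using assms(3) by auto
  then show ?thesis
    unfolding h.hom_family_pull k.hom_family_pull h.pull_irr_filters k.pull_irr_filters by simp
qed

section \<open>Congruences and quotients\<close>

lemma congruence_hom_kernel:
  assumes "slata A" "slata_hom A B h"
  shows "congruence A (hom_kernel A h)"
proof -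
  interpret slata A by fact
  show ?thesis
    using assms(2) unfolding congruence_def equiv_def refl_on_def sym_def trans_def hom_kernel_def slata_hom_def
    by auto
qed

text \<open>Adjointness passes to homomorphic images although it is not stated by equations: it is equivalent
to the inequalities \<open>i(a \<and> b) \<le> i(a)\<close>, \<open>d(a \<and> b) \<le> d(a)\<close>, \<open>a \<le> d(i(a))\<close> and \<open>i(d(a)) \<le> a\<close>, which are
equations because \<open>s \<le> t\<close> means \<open>s = s \<and> t\<close>.\<close>

lemma slata_hom_image:
  assumes "slata A" and hom: "slata_hom A B h" and surj: "h ` carr A = carr B"
  shows "slata B"
proof -
  interpret slata A by fact
  have h: "\<And>a b. a \<in> carr A \<Longrightarrow> b \<in> carr A \<Longrightarrow> meet B (h a) (h b) = h (meet A a b)"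
    "unit B = h (unit A)" "\<And>a. a \<in> carr A \<Longrightarrow> iop B (h a) = h (iop A a)"
    "\<And>a. a \<in> carr A \<Longrightarrow> dop B (h a) = h (dop A a)"
    using hom by (auto simp: slata_hom_def)
  have "semilattice_alg B"
    unfolding semilattice_alg_def surj[symmetric] ball_simps
    by (auto simp: h meet_assoc intro: arg_cong[where f = h] meet_comm)
  then interpret B: semilat B by unfold_locales
  have mono: "sl_le B (h a) (h b)" if "sl_le A a b" "a \<in> carr A" "b \<in> carr A" for a b
    using that h(1)[of a b] unfolding sl_le_def by metis
  have closed: "h a \<in> carr B" if "a \<in> carr A" for a using that surj by blast
  have adj: "sl_le B (iop B (h a)) (h b) \<longleftrightarrow> sl_le B (h a) (dop B (h b))"
    if ab: "a \<in> carr A" "b \<in> carr A" for a b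
  proof
    assume "sl_le B (iop B (h a)) (h b)"
    then have "h (iop A a) = h (meet A (iop A a) b)" using ab by (simp add: sl_le_def h)
    then have "h (dop A (iop A a)) = h (dop A (meet A (iop A a) b))"
      using ab h(4)[of "iop A a"] h(4)[of "meet A (iop A a) b"] by simp
    moreover have "sl_le B (h a) (h (dop A (iop A a)))" by (rule mono) (use ab le_dop_iop in auto)
    moreover have "sl_le B (h (dop A (meet A (iop A a) b))) (h (dop A b))"
      by (rule mono) (use ab dop_mono meet_le2 in auto)
    ultimately have "sl_le B (h a) (h (dop A b))"
      using B.le_trans[of "h a" "h (dop A (iop A a))" "h (dop A b)"] ab closed by simp
    then show "sl_le B (h a) (dop B (h b))" using ab by (simp add: h)
  next
    assume "sl_le B (h a) (dop B (h b))"
    then have "h a = h (meet A a (dop A b))" using ab by (simp add: sl_le_def h)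
    then have "h (iop A a) = h (iop A (meet A a (dop A b)))"
      using ab h(3)[of a] h(3)[of "meet A a (dop A b)"] by simp
    moreover have "sl_le B (h (iop A (meet A a (dop A b)))) (h (iop A (dop A b)))"
      by (rule mono) (use ab iop_mono meet_le2 in auto)
    moreover have "sl_le B (h (iop A (dop A b))) (h b)" by (rule mono) (use ab iop_dop_le in auto)
    ultimately have "sl_le B (h (iop A a)) (h b)"
      using B.le_trans[of "h (iop A a)" "h (iop A (dop A b))" "h b"] ab closed by simp
    then show "sl_le B (iop B (h a)) (h b)" using ab by (simp add: h)
  qed
  have "slata_alg B"
    unfolding slata_alg_def surj[symmetric]
    using B.semilattice_alg adj by (auto simp: h)
  then show ?thesis by unfold_locales
qed

lemma quotient_slata_ops:
  assumes "slata A" and \<theta>: "congruence A \<theta>"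
  shows "slata_hom A (quotient_slata A \<theta>) (quot_map \<theta>)"
    and "quot_map \<theta> ` carr A = carr (quotient_slata A \<theta>)"
    and "hom_kernel A (quot_map \<theta>) = \<theta>"
proof -
  interpret slata A by fact
  have eq: "equiv (carr A) \<theta>"
    and cong: "\<And>a b c d. (a, b) \<in> \<theta> \<Longrightarrow> (c, d) \<in> \<theta> \<Longrightarrow> (meet A a c, meet A b d) \<in> \<theta>"
      "\<And>a b. (a, b) \<in> \<theta> \<Longrightarrow> (iop A a, iop A b) \<in> \<theta>"
      "\<And>a b. (a, b) \<in> \<theta> \<Longrightarrow> (dop A a, dop A b) \<in> \<theta>"
    using \<theta> unfolding congruence_def by blast+
  have q_eq: "quot_map \<theta> a = quot_map \<theta> b \<longleftrightarrow> (a, b) \<in> \<theta>" if "a \<in> carr A" "b \<in> carr A" for a b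
    unfolding quot_map_def using eq_equiv_class_iff[OF eq that] .
  have q_cong: "quot_map \<theta> a = quot_map \<theta> b" if "(a, b) \<in> \<theta>" for a b
    unfolding quot_map_def using equiv_class_eq[OF eq that] .
  have self: "(a, a) \<in> \<theta>" if "a \<in> carr A" for a
    using eq that by (auto simp: equiv_def refl_on_def)
  have un1: "(\<Union>x\<in>quot_map \<theta> a. quot_map \<theta> (f x)) = quot_map \<theta> (f a)"
    if a: "a \<in> carr A" and f: "\<And>x y. (x, y) \<in> \<theta> \<Longrightarrow> (f x, f y) \<in> \<theta>" for a and f
  proof -
    have "quot_map \<theta> (f x) = quot_map \<theta> (f a)" if "x \<in> quot_map \<theta> a" for x
      using q_cong[OF f, of a x] that by (simp add: quot_map_def)
    moreover have "a \<in> quot_map \<theta> a" using self[OF a] by (simp add: quot_map_def)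
    ultimately show ?thesis by blast
  qed
  have un2: "(\<Union>x\<in>quot_map \<theta> a. \<Union>y\<in>quot_map \<theta> b. quot_map \<theta> (meet A x y)) = quot_map \<theta> (meet A a b)"
    if ab: "a \<in> carr A" "b \<in> carr A" for a b
  proof -
    have "quot_map \<theta> (meet A x y) = quot_map \<theta> (meet A a b)"
      if "x \<in> quot_map \<theta> a" "y \<in> quot_map \<theta> b" for x y
      using q_cong[OF cong(1), of a x b y] that by (simp add: quot_map_def)
    moreover have "a \<in> quot_map \<theta> a" "b \<in> quot_map \<theta> b" using self ab by (simp_all add: quot_map_def)
    ultimately show ?thesis by blast
  qed
  show img: "quot_map \<theta> ` carr A = carr (quotient_slata A \<theta>)"
    by (auto simp: quotient_slata_def quotient_def quot_map_def)
  show "slata_hom A (quotient_slata A \<theta>) (quot_map \<theta>)"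
    unfolding slata_hom_def
  proof (intro conjI ballI)
    show "quot_map \<theta> a \<in> carr (quotient_slata A \<theta>)" if "a \<in> carr A" for a using img that by blast
  qed (simp_all add: quotient_slata_def un1 un2 cong)
  have "\<theta> \<subseteq> carr A \<times> carr A" using eq by (auto simp: equiv_def refl_on_def)
  then show "hom_kernel A (quot_map \<theta>) = \<theta>"
    unfolding hom_kernel_def using q_eq by auto
qed

lemma slata_surj_quotient:
  assumes "slata A" "congruence A \<theta>"
  shows "slata_surj A (quotient_slata A \<theta>) (quot_map \<theta>)"
  using slata_hom_image[OF assms(1) quotient_slata_ops(1,2)[OF assms]] quotient_slata_ops(1,2)[OF assms] assms(1)
  by (simp add: slata_surj_def slata_surj_axioms_def)

lemma family_of_cong_eq: "family_of_cong A \<theta> = hom_family A (quotient_slata A \<theta>) (quot_map \<theta>)"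
  by (simp add: family_of_cong_def hom_family_def)

theorem cong_of_family_of_cong:
  assumes "slata A" "congruence A \<theta>"
  shows "cong_of_family A (family_of_cong A \<theta>) = \<theta>"
  using slata_surj.cong_of_hom_family[OF slata_surj_quotient[OF assms]] quotient_slata_ops(3)[OF assms]
  by (simp add: family_of_cong_eq)

theorem family_of_cong_Vietoris:
  assumes "slata A" "congruence A \<theta>" "\<theta> \<noteq> carr A \<times> carr A"
  shows "dual_SLata_Vietoris A (family_of_cong A \<theta>)"
proof -
  interpret slata_surj A "quotient_slata A \<theta>" "quot_map \<theta>"
    by (rule slata_surj_quotient[OF assms(1,2)])
  have "carr (quotient_slata A \<theta>) \<noteq> {unit (quotient_slata A \<theta>)}"
  proof
    assume "carr (quotient_slata A \<theta>) = {unit (quotient_slata A \<theta>)}"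
    then have "hom_kernel A (quot_map \<theta>) = carr A \<times> carr A"
      using h_closed unfolding hom_kernel_def by auto
    then show False using assms(3) quotient_slata_ops(3)[OF assms(1,2)] by simp
  qed
  then show ?thesis unfolding family_of_cong_eq by (rule hom_family_Vietoris)
qed

text \<open>The total congruence is the exceptional case of the correspondence: its quotient has one element,
the only filter of which is not proper.\<close>

lemma family_of_total_congruence:
  assumes "slata A"
  shows "congruence A (carr A \<times> carr A)" "family_of_cong A (carr A \<times> carr A) = {}"
proof -
  interpret slata A by fact
  show c: "congruence A (carr A \<times> carr A)"
    by (auto simp: congruence_def equiv_def refl_on_def sym_def trans_def)
  let ?Q = "quotient_slata A (carr A \<times> carr A)"
  interpret slata_surj A ?Q "quot_map (carr A \<times> carr A)"
    by (rule slata_surj_quotient[OF assms c])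
  have "b = unit ?Q" if "b \<in> carr ?Q" for b
    using that by (auto simp: quotient_slata_def quotient_def quot_map_def)
  then have "F = carr ?Q" if "sl_filter ?Q F" for F
    using B.filter_unit[OF that] B.filter_carr[OF that] by auto
  then have "irr_filters ?Q = {}" using B.irr_filter B.irr_proper by blast
  then show "family_of_cong A (carr A \<times> carr A) = {}" by (simp add: family_of_cong_def)
qed

section \<open>The congruence of a Vietoris family\<close>

locale slata_vietoris = slata A for A :: "'a slata" +
  fixes \<F> :: "'a set set set"
  assumes vietoris: "dual_SLata_Vietoris A \<F>"
begin

abbreviation M where "M \<equiv> M_of (K_dual A) \<F>"
abbreviation h where "h \<equiv> box_T A \<F> \<circ> beta A"

lemma family_SLata_space:
  "SLata_space \<F> M (hat_rel (K_dual A) \<F> (R_dual A (iop A))) (hat_rel (K_dual A) \<F> (R_dual A (dop A)))"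
  using vietoris unfolding dual_SLata_Vietoris_def SLata_Vietoris_def by blast

lemma family_S_space: "S_space \<F> M"
  using vietoris unfolding dual_SLata_Vietoris_def SLata_Vietoris_def by blast

lemma subbasic: "Y \<in> \<F> \<Longrightarrow> Y \<in> subbasic_closed (irr_filters A) (K_dual A)"
  using vietoris unfolding dual_SLata_Vietoris_def SLata_Vietoris_def by blast

lemma member_irr: "\<forall>Y\<in>\<F>. Y \<subseteq> irr_filters A"
  using subbasic by (auto simp: subbasic_closed_def)

text \<open>Members of the family are subbasic closed, so the \<open>\<beta>(a)\<close> that include them determine them.\<close>

lemma member_eq:
  assumes "Y \<in> \<F>" shows "Y = {P \<in> irr_filters A. \<forall>a\<in>carr A. Y \<subseteq> beta A a \<longrightarrow> a \<in> P}"
proof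
  show "Y \<subseteq> {P \<in> irr_filters A. \<forall>a\<in>carr A. Y \<subseteq> beta A a \<longrightarrow> a \<in> P}"
    using member_irr assms by (auto simp: beta_def)
next
  obtain \<A> where \<A>: "\<A> \<subseteq> beta A ` carr A" "Y = irr_filters A \<inter> \<Inter>\<A>"
    using subbasic[OF assms] unfolding subbasic_closed_def dual.S_of_eq dual_up by blast
  show "{P \<in> irr_filters A. \<forall>a\<in>carr A. Y \<subseteq> beta A a \<longrightarrow> a \<in> P} \<subseteq> Y"
  proof
    fix P assume P: "P \<in> {P \<in> irr_filters A. \<forall>a\<in>carr A. Y \<subseteq> beta A a \<longrightarrow> a \<in> P}"
    have "P \<in> B" if B: "B \<in> \<A>" for B
    proof -
      obtain a where a: "a \<in> carr A" "B = beta A a" using \<A> B by auto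
      have "Y \<subseteq> beta A a" using \<A> B a by auto
      then show ?thesis using P a by (auto simp: beta_def)
    qed
    then show "P \<in> Y" using P \<A> by auto
  qed
qed

lemma h_eq: "h a = {Y \<in> \<F>. Y \<subseteq> beta A a}"
proof -
  have "T_rel A \<F> `` {Y} = Y" if "Y \<in> \<F>" for Y
    using that member_irr by (auto simp: T_rel_def)
  then show ?thesis by (auto simp: box_T_def)
qed

lemma h_compl: "h a = \<F> - hit \<F> (irr_filters A - beta A a)"
  unfolding h_eq hit_beta[OF member_irr] by auto

lemma h_surj: "h ` carr A = S_of \<F> M"
  unfolding S_of_def M_of_def K_dual_def using h_compl by auto

text \<open>The box operator of the lifted relation on \<open>\<F>\<close> mirrors \<open>f\<close>. If \<open>Y\<close> is not included in \<open>\<beta>(f a)\<close>, the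
complement of \<open>h a\<close> is related to \<open>Y\<close> and avoids \<open>h a\<close>; that it is related to \<open>Y\<close> is the condition
on increasing sets, since a set \<open>h b\<close> missed by it would be included in \<open>h a\<close>.\<close>

lemma m_hat_rel:
  assumes f: "\<And>a. a \<in> carr A \<Longrightarrow> f a \<in> carr A"
    "\<And>a b. a \<in> carr A \<Longrightarrow> b \<in> carr A \<Longrightarrow> a \<sqsubseteq> b \<Longrightarrow> f a \<sqsubseteq> f b"
    and inc: "\<And>Y. Y \<in> \<F> \<Longrightarrow> M_increasing (K_dual A) \<F> (R_dual A f `` Y)"
    and a: "a \<in> carr A"
  shows "m_of \<F> M (hat_rel (K_dual A) \<F> (R_dual A f)) (h a) = h (f a)"
proof -
  have hat: "hat_rel (K_dual A) \<F> (R_dual A f) =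
    {(Y, Z). Y \<in> \<F> \<and> Z \<in> Z_of \<F> M \<and> (\<forall>a\<in>carr A. Y \<subseteq> beta A (f a) \<longrightarrow> Z \<inter> h a \<noteq> {})}"
    unfolding h_eq using f member_irr by (rule hat_rel_dual)
  have "Y \<in> m_of \<F> M (hat_rel (K_dual A) \<F> (R_dual A f)) (h a) \<longleftrightarrow> Y \<subseteq> beta A (f a)" if Y: "Y \<in> \<F>" for Y
  proof
    assume "Y \<subseteq> beta A (f a)"
    then show "Y \<in> m_of \<F> M (hat_rel (K_dual A) \<F> (R_dual A f)) (h a)"
      using Y a unfolding m_of_def L_of_def hat by auto
  next
    assume m: "Y \<in> m_of \<F> M (hat_rel (K_dual A) \<F> (R_dual A f)) (h a)"
    have incr: "\<forall>a\<in>carr A. \<forall>b\<in>carr A. h a \<subseteq> h b \<longrightarrow> Y \<subseteq> beta A (f a) \<longrightarrow> Y \<subseteq> beta A (f b)"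
      using M_increasing_dual[of f, OF f member_irr Y] inc[OF Y] unfolding h_eq by simp
    show "Y \<subseteq> beta A (f a)"
    proof (rule ccontr)
      assume na: "\<not> Y \<subseteq> beta A (f a)"
      have "(\<F> - h a) \<inter> h b \<noteq> {}" if b: "b \<in> carr A" "Y \<subseteq> beta A (f b)" for b
      proof
        assume "(\<F> - h a) \<inter> h b = {}"
        then have "h b \<subseteq> h a" unfolding h_eq by blast
        then show False using incr a b na by blast
      qed
      moreover have "\<F> - h a \<in> Z_of \<F> M"
      proof (rule Z_of_K)
        have "\<F> - h a = hit \<F> (irr_filters A - beta A a)" unfolding h_compl by (auto simp: hit_def)
        then show "\<F> - h a \<in> M" using a unfolding M_of_def K_dual_def by blast
      qed blast
      ultimately have "(Y, \<F> - h a) \<in> hat_rel (K_dual A) \<F> (R_dual A f)" unfolding hat using Y by blast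
      then show False using m by (auto simp: m_of_def L_of_def)
    qed
  qed
  then show ?thesis unfolding h_eq by (auto simp: m_of_def)
qed

lemma family_slata_alg: "slata_alg (family_slata A \<F>)"
  unfolding family_slata_def by (rule SLata_space_slata_alg[OF family_SLata_space])

lemma box_T_hom: "slata_hom A (family_slata A \<F>) h"
  unfolding slata_hom_def
proof (intro conjI ballI)
  have inc: "M_increasing (K_dual A) \<F> (R_dual A (iop A) `` Y)" "M_increasing (K_dual A) \<F> (R_dual A (dop A) `` Y)"
    if "Y \<in> \<F>" for Y
    using vietoris that unfolding dual_SLata_Vietoris_def SLata_Vietoris_def by blast+
  fix a assume a: "a \<in> carr A"
  show "h a \<in> carr (family_slata A \<F>)" using a h_surj unfolding family_slata_def by auto
  show "h (iop A a) = iop (family_slata A \<F>) (h a)"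
    using m_hat_rel[of "iop A" a, OF iop_closed iop_mono inc(1) a] by (simp add: family_slata_def)
  show "h (dop A a) = dop (family_slata A \<F>) (h a)"
    using m_hat_rel[of "dop A" a, OF dop_closed dop_mono inc(2) a] by (simp add: family_slata_def)
  fix b assume b: "b \<in> carr A"
  have "beta A (a \<sqinter> b) = beta A a \<inter> beta A b" using dual.up_meet[OF a b] by (simp add: dual_up)
  then show "h (meet A a b) = meet (family_slata A \<F>) (h a) (h b)"
    unfolding h_eq by (auto simp: family_slata_def)
next
  have "beta A (unit A) = irr_filters A" using dual.up_unit by (simp add: dual_up)
  then show "h (unit A) = unit (family_slata A \<F>)"
    unfolding h_eq using member_irr by (auto simp: family_slata_def)
qed

sublocale box: slata_surj A "family_slata A \<F>" h
  by unfold_locales (use family_slata_alg box_T_hom h_surj in \<open>auto simp: family_slata_def\<close>)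

text \<open>The irreducible filters of the closed sets of \<open>\<F>\<close> are given by the points \<open>Y\<close> of \<open>\<F>\<close>. The preimage
of such a filter is \<open>{a. Y \<subseteq> \<beta>(a)}\<close>, and its fibre is \<open>Y\<close> by \<open>member_eq\<close>.\<close>

lemma box_hom_family: "hom_family A (family_slata A \<F>) h = \<F>"
proof -
  have irr: "irr_filters (family_slata A \<F>) = (\<lambda>Y. {U \<in> S_of \<F> M. Y \<in> U}) ` \<F>"
    by (rule S_space_irr_filters[OF family_S_space]) (simp_all add: family_slata_def)
  have "box.fibre {U \<in> S_of \<F> M. Y \<in> U} = Y" if Y: "Y \<in> \<F>" for Y
  proof -
    have "box.pull {U \<in> S_of \<F> M. Y \<in> U} = {a \<in> carr A. Y \<subseteq> beta A a}"
      unfolding box.pull_def h_surj[symmetric] using Y unfolding h_eq by auto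
    then show ?thesis unfolding box.fibre_def using member_eq[OF Y] by blast
  qed
  then show ?thesis unfolding box.hom_family_fibre irr by (simp add: image_image)
qed

lemma cong_of_family_kernel: "cong_of_family A \<F> = hom_kernel A h"
  using box.cong_of_hom_family unfolding box_hom_family .

lemma cong_of_family_congruence: "congruence A (cong_of_family A \<F>)"
  unfolding cong_of_family_kernel by (rule congruence_hom_kernel[OF slata_axioms box_T_hom])

theorem family_of_cong_of_family: "family_of_cong A (cong_of_family A \<F>) = \<F>"
proof -
  note c = slata_axioms cong_of_family_congruence
  have "hom_family A (quotient_slata A (cong_of_family A \<F>)) (quot_map (cong_of_family A \<F>)) =
      hom_family A (family_slata A \<F>) h"
    by (rule hom_family_cong_kernel[OF slata_surj_quotient[OF c] box.slata_surj_axioms])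
      (rule trans[OF quotient_slata_ops(3)[OF c] cong_of_family_kernel])
  then show ?thesis unfolding family_of_cong_eq box_hom_family .
qed

end

theorem theorem4p5:
  fixes A :: "'a slata"
  assumes "slata_alg A"
  shows
    "(\<forall>\<theta>. congruence A \<theta> \<longrightarrow>
        (\<theta> \<noteq> carr A \<times> carr A \<longrightarrow> dual_SLata_Vietoris A (family_of_cong A \<theta>)) \<and>
        \<theta> = cong_of_family A (family_of_cong A \<theta>)) \<and>
     (\<forall>\<F>. dual_SLata_Vietoris A \<F> \<longrightarrow>
        congruence A (cong_of_family A \<F>) \<and>
        \<F> = family_of_cong A (cong_of_family A \<F>) \<and>
        slata_alg (family_slata A \<F>) \<and>
        slata_hom A (family_slata A \<F>) (box_T A \<F> \<circ> beta A) \<and>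
        cong_of_family A \<F> = hom_kernel A (box_T A \<F> \<circ> beta A)) \<and>
     bij_betw (family_of_cong A)
       {\<theta>. congruence A \<theta> \<and> \<theta> \<noteq> carr A \<times> carr A} {\<F>. dual_SLata_Vietoris A \<F>} \<and>
     bij_betw (family_of_cong A)
       {\<theta>. congruence A \<theta>} (insert {} {\<F>. dual_SLata_Vietoris A \<F>})"
proof -
  have A: "slata A" using assms by unfold_locales
  have V: "slata_vietoris A \<F>" if "dual_SLata_Vietoris A \<F>" for \<F>
    using A that by (simp add: slata_vietoris_def slata_vietoris_axioms_def)
  note total = family_of_total_congruence[OF A]
  have ne: "\<not> dual_SLata_Vietoris A {}"
    by (simp add: dual_SLata_Vietoris_def SLata_Vietoris_def)
  have proper: "cong_of_family A \<F> \<noteq> carr A \<times> carr A" if "dual_SLata_Vietoris A \<F>" for \<F>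
    using slata_vietoris.family_of_cong_of_family[OF V[OF that]] total(2) ne that by metis
  have proper_bij: "bij_betw (family_of_cong A)
      {\<theta>. congruence A \<theta> \<and> \<theta> \<noteq> carr A \<times> carr A} {\<F>. dual_SLata_Vietoris A \<F>}"
  proof (rule bij_betw_byWitness[where f' = "cong_of_family A"])
    show "\<forall>\<theta>\<in>{\<theta>. congruence A \<theta> \<and> \<theta> \<noteq> carr A \<times> carr A}. cong_of_family A (family_of_cong A \<theta>) = \<theta>"
      using cong_of_family_of_cong[OF A] by simp
    show "\<forall>\<F>\<in>{\<F>. dual_SLata_Vietoris A \<F>}. family_of_cong A (cong_of_family A \<F>) = \<F>"
      using slata_vietoris.family_of_cong_of_family[OF V] by simp
    show "family_of_cong A ` {\<theta>. congruence A \<theta> \<and> \<theta> \<noteq> carr A \<times> carr A} \<subseteq> {\<F>. dual_SLata_Vietoris A \<F>}"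
      using family_of_cong_Vietoris[OF A] by auto
    show "cong_of_family A ` {\<F>. dual_SLata_Vietoris A \<F>} \<subseteq> {\<theta>. congruence A \<theta> \<and> \<theta> \<noteq> carr A \<times> carr A}"
      using slata_vietoris.cong_of_family_congruence[OF V] proper by auto
  qed
  \<comment> \<open>The remaining correspondence adds one point on each side: the total congruence and the empty family.\<close>
  have split: "{\<theta>. congruence A \<theta>} = insert (carr A \<times> carr A) {\<theta>. congruence A \<theta> \<and> \<theta> \<noteq> carr A \<times> carr A}"
    using total(1) by auto
  have "bij_betw (family_of_cong A) {\<theta>. congruence A \<theta>} (insert {} {\<F>. dual_SLata_Vietoris A \<F>})"
    using notIn_Un_bij_betw[OF _ _ proper_bij, of "carr A \<times> carr A"] total(2) ne unfolding split by simp
  then show ?thesis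
    using proper_bij family_of_cong_Vietoris[OF A] cong_of_family_of_cong[OF A]
      slata_vietoris.cong_of_family_congruence[OF V] slata_vietoris.family_of_cong_of_family[OF V]
      slata_vietoris.family_slata_alg[OF V] slata_vietoris.box_T_hom[OF V]
      slata_vietoris.cong_of_family_kernel[OF V]
    by (intro conjI allI impI) simp_all
qed

end
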